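(* Suppose $\mathcal{H}$ is infinite dimensional and $A\in\mathcal{B}(\mathcal{H})$. Let $\mathcal{S}$ be a set of finite rank operators in $\mathcal{B}(\mathcal{H})$ containing the set $$\{2e^{i\xi}\|A\|P: \xi\in[0,2\pi),\ P\text{ is a finite rank orthogonal projection}\}.$$ Then the following equalities hold: (1) $\Omega_\infty(A)=\bigcap_{k\ge1}\Omega_k(A)=\bigcap\{\mathrm{Cl}(W(A+F)): F\in\mathcal{S}\}=W_e(A)$; (2) $\Lambda_\infty(A)=\bigcap_{k\ge1}\Lambda_k(A)=\bigcap\{W(A+F): F\in\mathcal{S}\}$.
   Context: $\mathcal{B}(\mathcal{H})$ is the algebra of bounded linear operators on the complex Hilbert space $\mathcal{H}$, with operator norm $\|\cdot\|$. For a positive integer $k$ or $k=\infty$, $\Lambda_k(A)=\{\lambda\in\mathbb{C}: PAP=\lambda P\text{ for some rank-}k\text{ orthogonal projection }P\in\mathcal{B}(\mathcal{H})\}$ (for $k=\infty$: $P$ of infinite rank; equivalently, there is an infinite orthonormal sequence $(x_i)_{i\ge1}$ with $\langle Ax_i,x_j\rangle=\delta_{ij}\lambda$ for all $i,j$). $W(A)=\{\langle Ax,x\rangle: x\in\mathcal{H},\ \langle x,x\rangle=1\}$, and $\mathrm{Cl}$ denotes closure in $\mathbb{C}$. The essential numerical range is $W_e(A)=\bigcap\{\mathrm{Cl}(W(A+F)): F\in\mathcal{B}(\mathcal{H})\text{ has finite rank}\}$. For a Hermitian matrix, $\lambda_k$ denotes its $k$-th largest eigenvalue; for a self-adjoint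 operator $H$ and a positive integer $k$, $\lambda_k(H)=\sup\{\lambda_k(X^*HX): X:\mathbb{C}^k\to\mathcal{H},\ X^*X=I_k\}$. With $\mathrm{Re}(A)=(A+A^* )/2$, for a positive integer $k$, $$\Omega_k(A)=\bigcap_{\xi\in[0,2\pi)}\{\mu\in\mathbb{C}: \mathrm{Re}(e^{i\xi}\mu)\le\lambda_k(\mathrm{Re}(e^{i\xi}A))\},$$ and $$\Omega_\infty(A)=\bigcap_{\xi\in[0,2\pi)}\{\mu\in\mathbb{C}: \mathrm{Re}(e^{i\xi}\mu)\le\lambda_k(\mathrm{Re}(e^{i\xi}A))\text{ for all integers }k\ge1\}.$$ Intersections over $k\ge1$ run over positive (finite) integers $k$. *)

theory Defs
  imports "HOL-Analysis.Analysis" "Jordan_Normal_Form.Char_Poly"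
begin

text \<open>A complex Hilbert space is a complete real inner product space with a compatible complex
  scalar multiplication and a sesquilinear form, linear in the \<^emph>\<open>first\<close> argument, whose real
  part is the real inner product. Hence the library norm is the Hilbert norm, with square
  \<open>cinner x x\<close>.\<close>

class complex_hilbert = banach + real_inner +
  fixes scaleC :: "complex \<Rightarrow> 'a \<Rightarrow> 'a"  (infixr "*\<^sub>C" 75)
    and cinner :: "'a \<Rightarrow> 'a \<Rightarrow> complex"
  assumes scaleC_add_right: "a *\<^sub>C (x + y) = a *\<^sub>C x + a *\<^sub>C y"
    and scaleC_add_left: "(a + b) *\<^sub>C x = a *\<^sub>C x + b *\<^sub>C x"
    and scaleC_scaleC: "a *\<^sub>C (b *\<^sub>C x) = (a * b) *\<^sub>C x"
    and scaleR_eq_scaleC: "scaleR r x = complex_of_real r *\<^sub>C x"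
    and cinner_add_left: "cinner (x + y) z = cinner x z + cinner y z"
    and cinner_scaleC_left: "cinner (a *\<^sub>C x) y = a * cinner x y"
    and cinner_commute: "cinner x y = cnj (cinner y x)"
    and inner_eq_Re_cinner: "inner x y = Re (cinner x y)"

global_interpretation complex_vec: vector_space "scaleC :: complex \<Rightarrow> 'a \<Rightarrow> 'a::complex_hilbert"
  defines cspan = "module.span (scaleC :: complex \<Rightarrow> 'a \<Rightarrow> 'a)"
    and cdim = "vector_space.dim (scaleC :: complex \<Rightarrow> 'a \<Rightarrow> 'a)"
proof
  show "1 *\<^sub>C x = x" for x :: 'a
    using scaleR_eq_scaleC[of 1 x] by simp
qed (simp_all add: scaleC_add_right scaleC_add_left scaleC_scaleC)

lemma cinner_self: "cinner x x = complex_of_real ((norm x)\<^sup>2)"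
  for x :: "'a::complex_hilbert"
proof (rule complex_eqI)
  show "Re (cinner x x) = Re (complex_of_real ((norm x)\<^sup>2))"
    by (simp add: power2_norm_eq_inner inner_eq_Re_cinner)
  have "Im (cinner x x) = - Im (cinner x x)"
    using arg_cong[OF cinner_commute[of x x], of Im] by simp
  then show "Im (cinner x x) = Im (complex_of_real ((norm x)\<^sup>2))"
    by simp
qed

definition cfinite_dim :: "'a::complex_hilbert set \<Rightarrow> bool" where
  "cfinite_dim V \<longleftrightarrow> (\<exists>B. finite B \<and> V \<subseteq> cspan B)"

text \<open>Operators are plain functions satisfying the predicate below; the operator norm is \<^const>\<open>onorm\<close>.\<close>

definition bounded_clinear :: "('a::complex_hilbert \<Rightarrow> 'a) \<Rightarrow> bool" where
  "bounded_clinear T \<longleftrightarrow> bounded_linear T \<and> (\<forall>c x. T (c *\<^sub>C x) = c *\<^sub>C T x)"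

definition hadjoint :: "('a::complex_hilbert \<Rightarrow> 'a) \<Rightarrow> ('a \<Rightarrow> 'a)" where
  "hadjoint T = (THE S. \<forall>x y. cinner (T x) y = cinner x (S y))"

definition op_Re :: "('a::complex_hilbert \<Rightarrow> 'a) \<Rightarrow> ('a \<Rightarrow> 'a)" where
  "op_Re T = (\<lambda>x. (1/2) *\<^sub>C (T x + hadjoint T x))"

definition oprank :: "('a::complex_hilbert \<Rightarrow> 'a) \<Rightarrow> enat" where
  "oprank T = (if cfinite_dim (range T) then enat (cdim (range T)) else \<infinity>)"

definition finite_rank_op :: "('a::complex_hilbert \<Rightarrow> 'a) \<Rightarrow> bool" where
  "finite_rank_op T \<longleftrightarrow> bounded_clinear T \<and> oprank T < \<infinity>"

definition orth_proj :: "('a::complex_hilbert \<Rightarrow> 'a) \<Rightarrow> bool" where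
  "orth_proj P \<longleftrightarrow> bounded_clinear P \<and> P \<circ> P = P \<and> hadjoint P = P"

definition num_range :: "('a::complex_hilbert \<Rightarrow> 'a) \<Rightarrow> complex set" where
  "num_range T = {cinner (T x) x | x. cinner x x = 1}"

definition ess_num_range :: "('a::complex_hilbert \<Rightarrow> 'a) \<Rightarrow> complex set" where
  "ess_num_range T = (\<Inter>F \<in> {F. finite_rank_op F}. closure (num_range (\<lambda>x. T x + F x)))"

definition Lambda :: "enat \<Rightarrow> ('a::complex_hilbert \<Rightarrow> 'a) \<Rightarrow> complex set" where
  "Lambda k T = {\<mu>. \<exists>P. orth_proj P \<and> oprank P = k \<and> P \<circ> T \<circ> P = (\<lambda>x. \<mu> *\<^sub>C P x)}"

text \<open>For a Hermitian matrix: the \<open>k\<close>-th entry, counting from 1, of the list of eigenvalues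
  in decreasing order, repeated according to multiplicity.\<close>

definition kth_largest_eigenvalue :: "nat \<Rightarrow> complex mat \<Rightarrow> real" where
  "kth_largest_eigenvalue k M =
     rev (sorted_list_of_multiset (image_mset Re (proots (char_poly M)))) ! (k - 1)"

text \<open>A linear map \<open>X\<close> from complex \<open>k\<close>-space to the Hilbert space is given by the images
  \<open>X 0, \<dots>, X (k - 1)\<close> of the standard basis vectors; \<open>compression k X T\<close> is then the
  \<open>k \<times> k\<close> matrix of \<open>X\<^sup>* T X\<close>.\<close>

definition compression ::
  "nat \<Rightarrow> (nat \<Rightarrow> 'a) \<Rightarrow> ('a::complex_hilbert \<Rightarrow> 'a) \<Rightarrow> complex mat" where
  "compression k X T = Matrix.mat k k (\<lambda>(i, j). cinner (T (X j)) (X i))"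

definition lambda_op :: "nat \<Rightarrow> ('a::complex_hilbert \<Rightarrow> 'a) \<Rightarrow> real" where
  "lambda_op k H =
     Sup {kth_largest_eigenvalue k (compression k X H) | X. compression k X id = 1\<^sub>m k}"

definition Omega :: "nat \<Rightarrow> ('a::complex_hilbert \<Rightarrow> 'a) \<Rightarrow> complex set" where
  "Omega k T = (\<Inter>\<xi> \<in> {0..<2*pi}.
     {\<mu>. Re (cis \<xi> * \<mu>) \<le> lambda_op k (op_Re (\<lambda>x. cis \<xi> *\<^sub>C T x))})"

definition Omega_infinity :: "('a::complex_hilbert \<Rightarrow> 'a) \<Rightarrow> complex set" where
  "Omega_infinity T = (\<Inter>\<xi> \<in> {0..<2*pi}.
     {\<mu>. \<forall>k\<ge>1. Re (cis \<xi> * \<mu>) \<le> lambda_op k (op_Re (\<lambda>x. cis \<xi> *\<^sub>C T x))})"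

end

theory Submission
  imports Defs
begin

text \<open>
  \<^emph>\<open>Part (1).\<close> Rotating \<open>A\<close> turns every statement about half-planes into one about the
  self-adjoint operator \<open>H = Re (e\<^sup>i\<^sup>\<xi> A)\<close>. A finite rank perturbation \<open>F\<close> vanishes on a unit vector of
  any space of dimension greater than its rank, so \<open>\<lambda>\<^sub>k(H)\<close> for such a dimension \<open>k\<close> is bounded by the
  supremum of the form of \<open>Re (e\<^sup>i\<^sup>\<xi> (A + F))\<close>. As the numerical range is convex
  (\<open>toeplitz_hausdorff\<close>), a point outside its closure is cut off by a half-plane; this gives
  \<open>\<Inter>\<^sub>k \<Omega>\<^sub>k(A) \<subseteq> W\<^sub>e(A)\<close> (\<open>Omega_subset_closure_num_range\<close>).

  Conversely let \<open>\<lambda>\<^sub>k(H) < c\<close>. Then \<open>H - c\<close> is nonpositive on the orthogonal complement of some finite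
  set, since otherwise unit vectors with \<open>\<langle>H w, w\<rangle> > c\<close> could be chosen one after the other,
  each orthogonal to the earlier ones and to their images (\<open>diagonalising_sequence\<close>); \<open>k\<close> of
  them would give a diagonal compression of \<open>H\<close> with all entries above \<open>c\<close>. A self-adjoint operator that is
  nonpositive on a space of finite codimension has finitely many positive eigenvalues,
  counted with multiplicity, and is nonpositive orthogonally to their eigenvectors
  (\<open>finite_positive_part\<close>). Subtracting \<open>2\<parallel>A\<parallel>\<close> times the projection \<open>P\<close> onto these
  eigenvectors pushes the form of \<open>H\<close> down to at most \<open>c\<close> on unit vectors (\<open>perturbed_form_le\<close>). Rotated back, that is a
  perturbation of the prescribed shape \<open>2 e\<^sup>i\<^sup>\<eta> \<parallel>A\<parallel> P\<close>, and every point outside \<open>\<Omega>\<^sub>k(A)\<close> is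
  excluded by a perturbation of this kind (\<open>closure_num_range_subset_Omega\<close>).

  \<^emph>\<open>Part (2).\<close> The inclusions \<open>\<Lambda>\<^sub>\<infinity> \<subseteq> \<Lambda>\<^sub>k\<close> and \<open>\<Inter>\<^sub>k \<Lambda>\<^sub>k \<subseteq> W(A + F)\<close> follow by
  choosing suitable vectors in the ranges of the given projections. For the remaining one it suffices
  to find, orthogonally to any finite set \<open>B\<close>, a unit vector \<open>w\<close>
  with \<open>\<langle>A w, w\<rangle> = \<mu>\<close>, because then the same successive choice produces an infinite orthonormal
  sequence on which \<open>A\<close> compresses to \<open>\<mu>\<close> (\<open>Lambda_infinityI\<close>). If there were no such \<open>w\<close>, the
  convex set of values \<open>\<langle>A w, w\<rangle>\<close> over unit vectors \<open>w \<bottom> B\<close> would lie in a closed half-plane with \<open>\<mu>\<close> on its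
  boundary line. The perturbation of part (1) now has to be exact: with \<open>P\<close> projecting onto the
  positive eigenvectors of \<open>H - c\<close> together with the projection of \<open>B\<close> to \<open>ker (H - c)\<close>, the
  boundary value \<open>c\<close> is attained by the perturbed form only at unit vectors \<open>x\<close> that are orthogonal to \<open>B\<close> and
  satisfy \<open>P x = 0\<close>, and there the perturbed value is \<open>\<langle>A x, x\<rangle> \<noteq> \<mu>\<close>. Hence \<open>\<mu>\<close> is missed by this perturbation
  (\<open>attained_on_finite_codimension\<close>).
\<close>

section \<open>The complex inner product\<close>

lemma cinner_add_right: "cinner x (y + z) = cinner x y + cinner x z"
  for x :: "'a::complex_hilbert"
  by (metis cinner_add_left cinner_commute complex_cnj_add)

lemma cinner_scaleC_right: "cinner x (a *\<^sub>C y) = cnj a * cinner x y"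
  for x :: "'a::complex_hilbert"
  by (metis cinner_scaleC_left cinner_commute complex_cnj_mult)

lemma norm_scaleC: "norm (a *\<^sub>C x) = cmod a * norm x"
  for x :: "'a::complex_hilbert"
proof -
  have "complex_of_real ((norm (a *\<^sub>C x))\<^sup>2) = a * cnj a * complex_of_real ((norm x)\<^sup>2)"
    by (simp only: cinner_self [symmetric] cinner_scaleC_left cinner_scaleC_right mult_ac)
  also have "\<dots> = complex_of_real ((cmod a * norm x)\<^sup>2)"
    by (simp add: complex_norm_square power_mult_distrib del: of_real_power)
  finally have "(norm (a *\<^sub>C x))\<^sup>2 = (cmod a * norm x)\<^sup>2"
    by (simp only: of_real_eq_iff)
  then show ?thesis by simp
qed

text \<open>The rotation that makes a complex number nonnegative. It reduces complex estimates to real ones, and in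
  the proof of convexity of the numerical range it makes the mixed terms real.\<close>

lemma complex_polar: obtains u where "cmod u = 1" "u * z = complex_of_real (cmod z)"
proof (cases "z = 0")
  case False
  then show ?thesis
    by (intro that [of "cnj z / of_real (cmod z)"])
      (simp_all add: norm_divide complex_norm_square [symmetric] mult.commute power2_eq_square)
qed (use that [of 1] in simp)

lemma cmod_cinner_le: "cmod (cinner x y) \<le> norm x * norm y"
  for x :: "'a::complex_hilbert"
proof -
  obtain u where u: "cmod u = 1" "u * cinner x y = complex_of_real (cmod (cinner x y))"
    by (rule complex_polar)
  have "cmod (cinner x y) = Re (u * cinner x y)" using u by simp
  also have "\<dots> = inner (u *\<^sub>C x) y"
    by (simp add: inner_eq_Re_cinner cinner_scaleC_left)
  also have "\<dots> \<le> norm (u *\<^sub>C x) * norm y" by (rule norm_cauchy_schwarz)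
  finally show ?thesis using u by (simp add: norm_scaleC)
qed

lemma bounded_bilinear_cinner: "bounded_bilinear (cinner :: 'a::complex_hilbert \<Rightarrow> 'a \<Rightarrow> complex)"
proof
  show "\<exists>K. \<forall>a b::'a. norm (cinner a b) \<le> norm a * norm b * K"
    by (rule exI [of _ 1]) (simp add: cmod_cinner_le)
qed (simp_all add: cinner_add_left cinner_add_right scaleR_eq_scaleC cinner_scaleC_left
      cinner_scaleC_right scaleR_conv_of_real)

lemma bounded_bilinear_scaleC: "bounded_bilinear (scaleC :: complex \<Rightarrow> 'a::complex_hilbert \<Rightarrow> 'a)"
proof
  show "\<exists>K. \<forall>a (b::'a). norm (a *\<^sub>C b) \<le> norm a * norm b * K"
    by (rule exI [of _ 1]) (simp add: norm_scaleC)
qed (simp_all add: scaleC_add_left scaleC_add_right scaleR_eq_scaleC scaleC_scaleC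
      scaleR_conv_of_real mult_ac)

lemmas cinner_simps =
  cinner_add_left cinner_add_right cinner_scaleC_left cinner_scaleC_right
  bounded_bilinear.diff_left [OF bounded_bilinear_cinner]
  bounded_bilinear.diff_right [OF bounded_bilinear_cinner]
  bounded_bilinear.minus_left [OF bounded_bilinear_cinner]
  bounded_bilinear.minus_right [OF bounded_bilinear_cinner]
  bounded_bilinear.zero_left [OF bounded_bilinear_cinner]
  bounded_bilinear.zero_right [OF bounded_bilinear_cinner]

lemmas cinner_sum_left = bounded_bilinear.sum_left [OF bounded_bilinear_cinner]
lemmas cinner_sum_right = bounded_bilinear.sum_right [OF bounded_bilinear_cinner]

lemma Re_cinner_self: "Re (cinner x x) = (norm x)\<^sup>2"
  for x :: "'a::complex_hilbert"
  by (simp add: cinner_self)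

lemma cinner_self_eq_1_iff: "cinner x x = 1 \<longleftrightarrow> norm x = 1"
  for x :: "'a::complex_hilbert"
proof -
  have "cinner x x = 1 \<longleftrightarrow> (norm x)\<^sup>2 = 1"
    by (simp only: cinner_self of_real_eq_1_iff)
  then show ?thesis by (simp add: power2_eq_1_iff) (use norm_ge_zero [of x] in linarith)
qed

lemma cinner_eq_zero_commute: "cinner x y = 0 \<longleftrightarrow> cinner y x = 0"
  for x :: "'a::complex_hilbert"
  by (metis cinner_commute complex_cnj_zero)

lemma Re_cinner_commute: "Re (cinner x y) = Re (cinner y x)"
  for x :: "'a::complex_hilbert"
  by (metis cinner_commute cnj.sel(1))

lemma pythagoras: "cinner x y = 0 \<Longrightarrow> (norm (x + y))\<^sup>2 = (norm x)\<^sup>2 + (norm y)\<^sup>2"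
  for x :: "'a::complex_hilbert"
  using cinner_eq_zero_commute [of x y]
  by (simp add: Re_cinner_self [symmetric] cinner_simps)

section \<open>Bounded operators\<close>

abbreviation csubspace :: "'a::complex_hilbert set \<Rightarrow> bool" where
  "csubspace \<equiv> module.subspace scaleC"

lemma bounded_clinearD:
  assumes "bounded_clinear T"
  shows "bounded_linear T" "T (c *\<^sub>C x) = c *\<^sub>C T x" "T (x + y) = T x + T y"
    "T (x - y) = T x - T y" "T 0 = 0" "T (- x) = - T x"
    "Vector_Spaces.linear scaleC scaleC T"
proof -
  show *: "bounded_linear T" and h: "T (c *\<^sub>C x) = c *\<^sub>C T x" for c x
    using assms by (auto simp: bounded_clinear_def)
  interpret bounded_linear T by fact
  show "T (x + y) = T x + T y" "T (x - y) = T x - T y" "T 0 = 0" "T (- x) = - T x"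
    by (simp_all add: add diff zero neg)
  show "Vector_Spaces.linear scaleC scaleC T"
    by unfold_locales (simp_all add: add h scaleC_add_left scaleC_add_right scaleC_scaleC)
qed

lemma bounded_clinear_sum: "bounded_clinear T \<Longrightarrow> T (sum f I) = (\<Sum>i\<in>I. T (f i))"
  by (rule linear_sum [OF bounded_linear.linear [OF bounded_clinearD(1)]])

lemma bounded_clinearI:
  assumes "\<And>x y. T (x + y) = T x + T y" "\<And>c x. T (c *\<^sub>C x) = c *\<^sub>C T x"
    and "\<And>x. norm (T x) \<le> norm x * b"
  shows "bounded_clinear T"
  unfolding bounded_clinear_def
  by (intro conjI bounded_linear_intro [of _ b] allI) (use assms in \<open>simp_all add: scaleR_eq_scaleC\<close>)

lemma bounded_clinear_add:
  "bounded_clinear S \<Longrightarrow> bounded_clinear T \<Longrightarrow> bounded_clinear (\<lambda>x. S x + T x)"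
  by (simp add: bounded_clinear_def bounded_linear_add scaleC_add_right)

lemma bounded_clinear_scaleC: "bounded_clinear T \<Longrightarrow> bounded_clinear (\<lambda>x. c *\<^sub>C T x)"
  by (simp add: bounded_clinear_def scaleC_scaleC mult.commute
      bounded_linear_compose [OF bounded_bilinear.bounded_linear_right [OF bounded_bilinear_scaleC]])

lemma bounded_clinear_ident: "bounded_clinear (\<lambda>x. x)"
  by (simp add: bounded_clinear_def)

lemma bounded_clinear_compose:
  "bounded_clinear S \<Longrightarrow> bounded_clinear T \<Longrightarrow> bounded_clinear (\<lambda>x. S (T x))"
  by (simp add: bounded_clinear_def bounded_linear_compose)

lemma bounded_clinear_diff:
  "bounded_clinear S \<Longrightarrow> bounded_clinear T \<Longrightarrow> bounded_clinear (\<lambda>x. S x - T x)"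
  by (simp add: bounded_clinear_def bounded_linear_sub complex_vec.scale_right_diff_distrib)

lemma norm_le_onorm: "bounded_clinear T \<Longrightarrow> norm (T x) \<le> onorm T * norm x"
  by (rule onorm [OF bounded_clinearD(1)])

lemma cmod_form_le: "bounded_clinear T \<Longrightarrow> cmod (cinner (T x) x) \<le> onorm T * (norm x)\<^sup>2"
  using cmod_cinner_le [of "T x" x] mult_right_mono [OF norm_le_onorm [of T x], of "norm x"]
  by (simp add: power2_eq_square mult.assoc)

lemma form_scaleC: "bounded_clinear T \<Longrightarrow>
    cinner (T (a *\<^sub>C x)) (a *\<^sub>C x) = complex_of_real ((cmod a)\<^sup>2) * cinner (T x) x"
  by (simp add: bounded_clinearD(2) cinner_simps complex_norm_square mult_ac del: of_real_power)

section \<open>Finite orthonormal sets\<close>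

definition ortho :: "'a::complex_hilbert set \<Rightarrow> 'a set" where
  "ortho B = {x. \<forall>b\<in>B. cinner x b = 0}"

definition orthonormal_set :: "'a::complex_hilbert set \<Rightarrow> bool" where
  "orthonormal_set E \<longleftrightarrow> (\<forall>e\<in>E. \<forall>f\<in>E. cinner e f = (if e = f then 1 else 0))"

text \<open>For a finite orthonormal set this is the orthogonal projection onto its span; the explicit sum
  shows its rank and boundedness without completeness of the span.\<close>

definition fproj :: "'a::complex_hilbert set \<Rightarrow> 'a \<Rightarrow> 'a" where
  "fproj E x = (\<Sum>e\<in>E. cinner x e *\<^sub>C e)"

lemma csubspace_ortho: "csubspace (ortho B)"
  by (auto simp: complex_vec.subspace_def ortho_def cinner_simps)

lemma closed_ortho: "closed (ortho B)"
proof -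
  have "ortho B = (\<Inter>b\<in>B. {x. cinner x b = 0})"
    by (auto simp: ortho_def)
  moreover have "closed {x. cinner x b = 0}" for b :: 'a
    by (intro closed_Collect_eq continuous_on_const linear_continuous_on
        bounded_bilinear.bounded_linear_left [OF bounded_bilinear_cinner])
  ultimately show ?thesis by auto
qed

lemma ortho_antimono_cspan: "B \<subseteq> cspan C \<Longrightarrow> ortho C \<subseteq> ortho B"
proof
  fix x assume B: "B \<subseteq> cspan C" and x: "x \<in> ortho C"
  have "cspan C \<subseteq> {y. cinner x y = 0}"
    by (rule complex_vec.span_minimal)
      (use x in \<open>auto simp: ortho_def complex_vec.subspace_def cinner_simps\<close>)
  with B show "x \<in> ortho B" by (auto simp: ortho_def)
qed

lemma orthonormal_set_norm: "orthonormal_set E \<Longrightarrow> e \<in> E \<Longrightarrow> norm e = 1"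
  by (simp add: orthonormal_set_def cinner_self_eq_1_iff [symmetric])

lemma orthonormal_set_insert:
  assumes "orthonormal_set E" "norm x = 1" "x \<in> ortho E"
  shows "orthonormal_set (insert x E)" "x \<notin> E"
proof -
  show "x \<notin> E"
    using assms cinner_self_eq_1_iff [of x] by (auto simp: ortho_def)
  moreover have "cinner e x = 0" if "e \<in> E" for e
    using that assms(3) by (simp add: ortho_def cinner_eq_zero_commute [of e])
  ultimately show "orthonormal_set (insert x E)"
    using assms cinner_self_eq_1_iff [of x] by (auto simp: orthonormal_set_def ortho_def)
qed

lemma cinner_sum_onset:
  assumes "finite E" "orthonormal_set E" "f \<in> E"
  shows "cinner (\<Sum>e\<in>E. a e *\<^sub>C e) f = a f"
proof -
  have "cinner (\<Sum>e\<in>E. a e *\<^sub>C e) f = (\<Sum>e\<in>E. if e = f then a e else 0)"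
    unfolding cinner_sum_left using assms
    by (intro sum.cong refl) (auto simp: orthonormal_set_def cinner_simps)
  then show ?thesis using assms by simp
qed

lemma orthonormal_set_independent:
  assumes "orthonormal_set E" shows "complex_vec.independent E"
proof
  assume "complex_vec.dependent E"
  then obtain e where e: "e \<in> E" "e \<in> cspan (E - {e})"
    unfolding complex_vec.dependent_def by blast
  have "e \<in> ortho (E - {e})" using assms e(1) by (auto simp: orthonormal_set_def ortho_def)
  with ortho_antimono_cspan [of "{e}" "E - {e}"] e(2) have "cinner e e = 0"
    by (auto simp: ortho_def)
  with assms e(1) show False by (auto simp: orthonormal_set_def)
qed

lemma fproj_in_cspan: "fproj E x \<in> cspan E"
  unfolding fproj_def
  by (intro complex_vec.span_sum complex_vec.span_scale complex_vec.span_base)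

lemma diff_fproj_ortho:
  assumes "finite E" "orthonormal_set E" shows "x - fproj E x \<in> ortho E"
  using assms by (simp add: ortho_def fproj_def cinner_simps cinner_sum_onset)

lemma ortho_cspan:
  assumes *: "w \<in> ortho E" "x \<in> cspan E"
  shows "cinner w x = 0" "cinner x w = 0"
proof -
  from * have "w \<in> ortho {x}" using ortho_antimono_cspan [of "{x}" E] by auto
  then show "cinner w x = 0" by (simp add: ortho_def)
  then show "cinner x w = 0" by (simp add: cinner_eq_zero_commute)
qed

lemma fproj_cspan:
  assumes "finite E" "orthonormal_set E" "x \<in> cspan E" shows "fproj E x = x"
proof -
  have "x - fproj E x \<in> cspan E"
    using assms(3) fproj_in_cspan by (rule complex_vec.span_diff)
  with ortho_cspan(1) [OF diff_fproj_ortho [OF assms(1,2), of x]]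
  have "cinner (x - fproj E x) (x - fproj E x) = 0" by blast
  then show ?thesis by (simp add: cinner_self)
qed

lemma fproj_ortho: "x \<in> ortho E \<Longrightarrow> fproj E x = 0"
  by (simp add: fproj_def ortho_def)

lemma range_fproj: "finite E \<Longrightarrow> orthonormal_set E \<Longrightarrow> range (fproj E) = cspan E"
  using fproj_in_cspan fproj_cspan by (metis rangeI subsetI subset_antisym image_subset_iff)

lemma fproj_symmetric: "finite E \<Longrightarrow> orthonormal_set E \<Longrightarrow> cinner (fproj E x) y = cinner x (fproj E y)"
  by (simp add: fproj_def cinner_sum_left cinner_sum_right cinner_simps cinner_commute [of _ y] mult_ac)

lemma norm_fproj_le:
  assumes "finite E" "orthonormal_set E" shows "norm (fproj E x) \<le> norm x"
proof -
  have "(norm (fproj E x + (x - fproj E x)))\<^sup>2 = (norm (fproj E x))\<^sup>2 + (norm (x - fproj E x))\<^sup>2"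
    by (intro pythagoras ortho_cspan(2) [OF diff_fproj_ortho [OF assms] fproj_in_cspan])
  then have "(norm (fproj E x))\<^sup>2 \<le> (norm x)\<^sup>2" by simp
  then show ?thesis by (rule power2_le_imp_le) simp
qed

lemma bounded_clinear_fproj:
  assumes "finite E" "orthonormal_set E" shows "bounded_clinear (fproj E)"
  by (rule bounded_clinearI [of _ 1])
    (use norm_fproj_le [OF assms] in \<open>simp_all add: fproj_def cinner_simps scaleC_add_left
      sum.distrib complex_vec.scale_sum_right scaleC_scaleC\<close>)

text \<open>Equality of the two spans, and not only \<open>B \<subseteq> cspan C\<close>, matters when \<open>B\<close> consists of eigenvectors:
  the vectors of \<open>C\<close> then stay in the same eigenspace.\<close>

lemma gram_schmidt:
  assumes "finite B"
  obtains C where "finite C" "orthonormal_set C" "B \<subseteq> cspan C" "C \<subseteq> cspan B" "card C \<le> card B"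
proof -
  have "\<exists>C. finite C \<and> orthonormal_set C \<and> B \<subseteq> cspan C \<and> C \<subseteq> cspan B \<and> card C \<le> card B"
    using assms
  proof induction
    case empty
    show ?case by (rule exI [of _ "{}"]) (simp add: orthonormal_set_def)
  next
    case (insert b B)
    then obtain C where C: "finite C" "orthonormal_set C" "B \<subseteq> cspan C" "card C \<le> card B"
        and CB: "C \<subseteq> cspan B" by blast
    have CB: "C \<subseteq> cspan (insert b B)"
      using CB complex_vec.span_mono [of B "insert b B"] by auto
    define r where "r = b - fproj C b"
    have r: "r \<in> ortho C" unfolding r_def by (rule diff_fproj_ortho [OF C(1,2)])
    show ?case
    proof (cases "r = 0")
      case True
      then have "b \<in> cspan C" using fproj_in_cspan [of C b] by (simp add: r_def)
      then show ?thesis using C CB insert by (intro exI [of _ C]) auto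
    next
      case False
      define u where "u = complex_of_real (1 / norm r) *\<^sub>C r"
      have u: "norm u = 1" using False by (simp add: u_def norm_scaleC norm_divide)
      have "u \<in> ortho C"
        unfolding u_def by (rule complex_vec.subspace_scale [OF csubspace_ortho r])
      with u C have o: "orthonormal_set (insert u C)" "u \<notin> C" by (auto intro: orthonormal_set_insert dest: orthonormal_set_insert)
      have "b = fproj C b + complex_of_real (norm r) *\<^sub>C u"
        using False by (simp add: u_def scaleC_scaleC r_def)
      also have "\<dots> \<in> cspan (insert u C)"
      proof (intro complex_vec.span_add complex_vec.span_scale)
        show "fproj C b \<in> cspan (insert u C)"
          using fproj_in_cspan [of C b] complex_vec.span_mono [of C "insert u C"] by auto
        show "u \<in> cspan (insert u C)" by (simp add: complex_vec.span_base)
      qed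
      finally have "b \<in> cspan (insert u C)" .
      moreover have "B \<subseteq> cspan (insert u C)"
        using C(3) complex_vec.span_mono [of C "insert u C"] by auto
      moreover have "u \<in> cspan (insert b B)"
      proof -
        have "fproj C b \<in> cspan (insert b B)"
          using fproj_in_cspan [of C b] complex_vec.span_minimal [OF CB complex_vec.subspace_span] by blast
        then show ?thesis
          unfolding u_def r_def
          by (intro complex_vec.span_scale complex_vec.span_diff) (simp_all add: complex_vec.span_base)
      qed
      ultimately show ?thesis using C CB o insert by (intro exI [of _ "insert u C"]) auto
    qed
  qed
  then show ?thesis using that by blast
qed

text \<open>The dimension count behind every comparison of a large rank with a small one: \<open>L\<close> would otherwise be injective on
  \<open>cspan B\<close> and carry \<open>B\<close> to more independent vectors than the span of \<open>C\<close> can hold.\<close>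

lemma kernel_meets_span:
  assumes B: "complex_vec.independent B" "finite B" and C: "finite C" "card C < card B"
    and L: "Vector_Spaces.linear scaleC scaleC L" and im: "L ` B \<subseteq> cspan C"
  obtains x where "x \<in> cspan B" "x \<noteq> 0" "L x = 0"
proof -
  interpret L: Vector_Spaces.linear "scaleC :: complex \<Rightarrow> 'a \<Rightarrow> 'a" "scaleC :: complex \<Rightarrow> 'b \<Rightarrow> 'b" L by fact
  have "\<not> inj_on L (cspan B)"
  proof
    assume inj: "inj_on L (cspan B)"
    then have "complex_vec.independent (L ` B)"
      using L.independent_injective_image [OF B(1)] by (simp add: cspan_def)
    then have "card (L ` B) \<le> card C"
      using complex_vec.independent_span_bound [OF C(1) _ im] by blast
    moreover have "card (L ` B) = card B"
      by (intro card_image inj_on_subset [OF inj] complex_vec.span_superset)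
    ultimately show False using C by simp
  qed
  then obtain x y where "x \<in> cspan B" "y \<in> cspan B" "L x = L y" "x \<noteq> y"
    by (auto simp: inj_on_def)
  then show ?thesis
    by (intro that [of "x - y"]) (auto intro: complex_vec.span_diff simp: L.diff)
qed

lemma ortho_meets_span:
  assumes B: "complex_vec.independent B" "finite B" and C: "finite C" "card C < card B"
  obtains x where "x \<in> cspan B" "x \<noteq> 0" "x \<in> ortho C"
proof -
  obtain D where D: "finite D" "orthonormal_set D" "C \<subseteq> cspan D" "D \<subseteq> cspan C" "card D \<le> card C"
    by (rule gram_schmidt [OF C(1)])
  obtain x where x: "x \<in> cspan B" "x \<noteq> 0" "fproj D x = 0"
    using kernel_meets_span [OF B D(1), of "fproj D"] D C fproj_in_cspan
      bounded_clinearD(7) [OF bounded_clinear_fproj [OF D(1,2)]]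
    by (metis image_subsetI le_less_trans)
  then have "x \<in> ortho D" using diff_fproj_ortho [OF D(1,2), of x] by simp
  with x show ?thesis using that ortho_antimono_cspan [OF D(3)] by blast
qed

section \<open>Riesz representation, adjoints and orthogonal projections\<close>

text \<open>The representing vector minimises \<open>\<parallel>x\<parallel>\<^sup>2 - 2 f x\<close> over \<open>L\<close>: by the parallelogram identity a minimising
  sequence is Cauchy, and the minimum is stationary in every direction of \<open>L\<close>. Allowing a
  subspace \<open>L\<close> makes one argument serve for adjoints (\<open>L = UNIV\<close>) and for orthogonal projections.\<close>

lemma riesz_closed_subspace:
  fixes f :: "'a::{banach, real_inner} \<Rightarrow> real"
  assumes L: "closed L" "subspace L" and f: "bounded_linear f"
  obtains z where "z \<in> L" "\<And>y. y \<in> L \<Longrightarrow> inner z y = f y"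
proof -
  interpret f: bounded_linear f by fact
  define J where "J x = (norm x)\<^sup>2 - 2 * f x" for x
  have J_ge: "J x \<ge> - (onorm f)\<^sup>2" for x
  proof -
    have "f x \<le> onorm f * norm x" using onorm [OF f, of x] by simp
    moreover have "0 \<le> (norm x - onorm f)\<^sup>2" by simp
    ultimately show ?thesis by (simp add: J_def power2_eq_square algebra_simps)
  qed
  define d where "d = Inf (J ` L)"
  have "0 \<in> L" using L(2) by (rule subspace_0)
  have bdd: "bdd_below (J ` L)" using J_ge by (intro bdd_belowI2)
  have d_le: "d \<le> J x" if "x \<in> L" for x
    unfolding d_def using bdd that by (intro cInf_lower) auto
  have "\<exists>x\<in>L. J x < d + inverse (real (Suc n))" for n
  proof -
    have "Inf (J ` L) < d + inverse (real (Suc n))" by (simp add: d_def)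
    then show ?thesis using cInf_less_iff [OF _ bdd] \<open>0 \<in> L\<close> by auto
  qed
  then obtain x where x: "\<And>n. x n \<in> L" "\<And>n. J (x n) < d + inverse (real (Suc n))"
    by metis
  have close: "(norm (x m - x n))\<^sup>2 \<le> 2 * (inverse (real (Suc m)) + inverse (real (Suc n)))" for m n
  proof -
    have "(1/2) *\<^sub>R (x m + x n) \<in> L"
      using x L(2) by (intro subspace_scale subspace_add)
    then have "d \<le> J ((1/2) *\<^sub>R (x m + x n))" by (rule d_le)
    moreover have "J (x m) + J (x n) - 2 * J ((1/2) *\<^sub>R (x m + x n)) = (norm (x m - x n))\<^sup>2 / 2"
      by (simp add: J_def f.add f.scaleR power2_norm_eq_inner inner_simps algebra_simps inner_commute)
    ultimately show ?thesis using x(2) [of m] x(2) [of n] by simp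
  qed
  have "Cauchy x"
  proof (rule metric_CauchyI)
    fix e :: real assume e: "0 < e"
    obtain N where N: "inverse (real (Suc N)) < e\<^sup>2 / 4"
      using reals_Archimedean [of "e\<^sup>2 / 4"] e by auto
    have "dist (x m) (x n) < e" if "m \<ge> N" "n \<ge> N" for m n
    proof -
      have "inverse (real (Suc m)) \<le> inverse (real (Suc N))" "inverse (real (Suc n)) \<le> inverse (real (Suc N))"
        using that by (simp_all add: field_simps)
      then have "2 * (inverse (real (Suc m)) + inverse (real (Suc n))) < 2 * (e\<^sup>2 / 4 + e\<^sup>2 / 4)"
        by (intro mult_strict_left_mono add_strict_mono le_less_trans [OF _ N]) auto
      with close [of m n] have "(norm (x m - x n))\<^sup>2 < e\<^sup>2" by simp
      then show ?thesis using e by (simp add: dist_norm power_less_imp_less_base)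
    qed
    then show "\<exists>M. \<forall>m\<ge>M. \<forall>n\<ge>M. dist (x m) (x n) < e" by blast
  qed
  then obtain z where z: "x \<longlonglongrightarrow> z" using Cauchy_convergent convergent_def by blast
  have zL: "z \<in> L" using L(1) x(1) z by (meson closed_sequentially)
  have "(\<lambda>n. J (x n)) \<longlonglongrightarrow> J z"
    unfolding J_def by (intro tendsto_intros z f.tendsto)
  moreover have "(\<lambda>n. d + inverse (real (Suc n))) \<longlonglongrightarrow> d + 0"
    by (intro tendsto_add tendsto_const LIMSEQ_inverse_real_of_nat)
  ultimately have Jz: "J z \<le> d" using x(2) by (intro LIMSEQ_le) (auto intro: less_imp_le)
  have "inner z y = f y" if y: "y \<in> L" for y
  proof (rule ccontr)
    define g where "g = inner z y - f y"
    \<comment> \<open>The minimiser of the quadratic in \<open>t\<close> would be \<open>- g / \<parallel>y\<parallel>\<^sup>2\<close>; adding 1 to the denominator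
      keeps it positive and the value still negative.\<close>
    define N where "N = (norm y)\<^sup>2 + 1"
    define t where "t = - g / N"
    assume "inner z y \<noteq> f y"
    then have g: "g\<^sup>2 > 0" by (simp add: g_def)
    have N: "N > 0" by (simp add: N_def add_nonneg_pos)
    have "z + t *\<^sub>R y \<in> L" using zL y L(2) by (intro subspace_add subspace_scale)
    then have "J z \<le> J (z + t *\<^sub>R y)" using Jz d_le by (meson order_trans)
    moreover have "J (z + t *\<^sub>R y) = J z + (t * t * (norm y)\<^sup>2 + 2 * t * g)"
      by (simp add: J_def g_def f.add f.scaleR power2_norm_eq_inner inner_simps algebra_simps
          inner_commute)
    ultimately have "0 \<le> t * t * (norm y)\<^sup>2 + 2 * t * g" by simp
    also have "\<dots> \<le> t * t * N + 2 * t * g"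
      by (simp add: N_def algebra_simps)
    also have "\<dots> = - g\<^sup>2 / N"
      using N by (simp add: t_def power2_eq_square field_simps)
    also have "\<dots> < 0" using g N by simp
    finally show False by simp
  qed
  with zL show ?thesis by (rule that)
qed

lemma csubspace_imp_subspace: "csubspace L \<Longrightarrow> subspace L"
  by (auto simp: subspace_def complex_vec.subspace_def scaleR_eq_scaleC)

text \<open>The real functional \<open>Re f\<close> determines \<open>f\<close>, because \<open>Im (f y) = - Re (f (\<i> y))\<close>.\<close>

lemma riesz_complex:
  fixes f :: "'a::complex_hilbert \<Rightarrow> complex"
  assumes L: "closed L" "csubspace L" and f: "bounded_linear f" "\<And>c x. f (c *\<^sub>C x) = c * f x"
  obtains z where "z \<in> L" "\<And>y. y \<in> L \<Longrightarrow> cinner y z = f y"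
proof -
  obtain z where z: "z \<in> L" "\<And>y. y \<in> L \<Longrightarrow> inner z y = Re (f y)"
    using riesz_closed_subspace [OF L(1) csubspace_imp_subspace [OF L(2)]
        bounded_linear_compose [OF bounded_linear_Re f(1)]] by blast
  have Re: "Re (cinner y z) = Re (f y)" if "y \<in> L" for y
    using z(2) [OF that] by (simp add: inner_eq_Re_cinner Re_cinner_commute)
  have "cinner y z = f y" if "y \<in> L" for y
  proof (rule complex_eqI [OF Re [OF that]])
    have "\<i> *\<^sub>C y \<in> L" using L(2) that by (rule complex_vec.subspace_scale)
    from Re [OF this] show "Im (cinner y z) = Im (f y)"
      by (simp add: cinner_simps f(2))
  qed
  with z(1) show ?thesis by (rule that)
qed

lemma cinner_ext: "(\<And>x. cinner x y = cinner x z) \<Longrightarrow> y = z"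
  for y :: "'a::complex_hilbert"
proof -
  assume "\<And>x. cinner x y = cinner x z"
  then have "cinner (y - z) (y - z) = 0" by (simp add: cinner_simps)
  then show ?thesis by (simp add: cinner_self)
qed

text \<open>Uniqueness of the adjoint, needed to evaluate its definition by definite description.\<close>

lemma hadjoint_eqI:
  assumes "\<And>x y. cinner (T x) y = cinner x (S y)" shows "hadjoint T = S"
  unfolding hadjoint_def
proof (rule the_equality)
  fix S' assume *: "\<forall>x y. cinner (T x) y = cinner x (S' y)"
  show "S' = S"
    by (rule ext, rule cinner_ext) (use * assms in metis)
qed (use assms in blast)

lemma cinner_hadjoint:
  assumes T: "bounded_clinear T" shows "cinner (T x) y = cinner x (hadjoint T y)"
proof -
  have "\<exists>z. \<forall>x. cinner (T x) y = cinner x z" for y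
  proof -
    obtain z where "\<And>x. x \<in> UNIV \<Longrightarrow> cinner x z = cinner (T x) y"
      by (rule riesz_complex [of UNIV "\<lambda>x. cinner (T x) y"])
        (auto simp: bounded_clinearD(2) [OF T] cinner_simps complex_vec.subspace_UNIV
          intro: bounded_linear_compose
              [OF bounded_bilinear.bounded_linear_left [OF bounded_bilinear_cinner]
                bounded_clinearD(1) [OF T]])
    then show ?thesis by (intro exI [of _ z]) simp
  qed
  then obtain S where "\<And>x y. cinner (T x) y = cinner x (S y)" by metis
  with hadjoint_eqI [OF this] show ?thesis by simp
qed

lemma bounded_clinear_hadjoint:
  assumes T: "bounded_clinear T" shows "bounded_clinear (hadjoint T)"
proof (rule bounded_clinearI [of _ "onorm T"])
  fix x y c
  show "hadjoint T (x + y) = hadjoint T x + hadjoint T y"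
    by (rule cinner_ext) (simp add: cinner_simps cinner_hadjoint [OF T, symmetric])
  show "hadjoint T (c *\<^sub>C x) = c *\<^sub>C hadjoint T x"
    by (rule cinner_ext) (simp add: cinner_simps cinner_hadjoint [OF T, symmetric])
  have "(norm (hadjoint T x))\<^sup>2 = Re (cinner (T (hadjoint T x)) x)"
    by (simp add: Re_cinner_self [symmetric] cinner_hadjoint [OF T])
  also have "\<dots> \<le> norm (T (hadjoint T x)) * norm x"
    using cmod_cinner_le complex_Re_le_cmod order_trans by blast
  also have "\<dots> \<le> onorm T * norm (hadjoint T x) * norm x"
    by (intro mult_right_mono norm_le_onorm T) simp
  finally have "norm (hadjoint T x) * norm (hadjoint T x) \<le> norm (hadjoint T x) * (norm x * onorm T)"
    by (simp add: power2_eq_square mult_ac)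
  then show "norm (hadjoint T x) \<le> norm x * onorm T"
    by (cases "hadjoint T x = 0") (auto simp: onorm_pos_le [OF bounded_clinearD(1) [OF T]])
qed

text \<open>Stated without \<open>hadjoint\<close>, so that it can be checked and used without evaluating the definite description.\<close>

definition self_adj :: "('a::complex_hilbert \<Rightarrow> 'a) \<Rightarrow> bool" where
  "self_adj T \<longleftrightarrow> bounded_clinear T \<and> (\<forall>x y. cinner (T x) y = cinner x (T y))"

lemma self_adjD:
  assumes "self_adj T"
  shows "bounded_clinear T" "cinner (T x) y = cinner x (T y)"
  using assms by (auto simp: self_adj_def)

lemma orth_projI: "self_adj P \<Longrightarrow> (\<And>x. P (P x) = P x) \<Longrightarrow> orth_proj P"
  unfolding orth_proj_def self_adj_def fun_eq_iff comp_def
  by (intro conjI allI fun_cong [OF hadjoint_eqI]) blast+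

lemma orth_projD:
  assumes "orth_proj P" shows "self_adj P" "P (P x) = P x"
  using assms cinner_hadjoint [of P] by (auto simp: orth_proj_def self_adj_def fun_eq_iff)

lemma orth_proj_fproj: "finite E \<Longrightarrow> orthonormal_set E \<Longrightarrow> orth_proj (fproj E)"
  by (intro orth_projI) (simp_all add: self_adj_def bounded_clinear_fproj fproj_symmetric
      fproj_cspan fproj_in_cspan)

lemma orth_proj_onto_closed:
  assumes L: "closed L" "csubspace L"
  obtains P where "orth_proj P" "range P = L" "\<And>x y. y \<in> L \<Longrightarrow> cinner (x - P x) y = 0"
proof -
  have "\<exists>z. z \<in> L \<and> (\<forall>y\<in>L. cinner y z = cinner y x)" for x
    by (rule riesz_complex [OF L, of "\<lambda>y. cinner y x"])
      (auto simp: cinner_simps bounded_bilinear.bounded_linear_left [OF bounded_bilinear_cinner])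
  then obtain P where P: "\<And>x. P x \<in> L" "\<And>x y. y \<in> L \<Longrightarrow> cinner y (P x) = cinner y x"
    by metis
  have P': "cinner (P x) y = cinner x y" if "y \<in> L" for x y
    using P(2) [OF that, of x] by (metis cinner_commute)
  have eqI: "u = v" if "u \<in> L" "v \<in> L" "\<And>y. y \<in> L \<Longrightarrow> cinner u y = cinner v y" for u v
  proof -
    have "cinner (u - v) (u - v) = 0"
      unfolding cinner_simps that(3) [OF that(1)] that(3) [OF that(2)] by simp
    then show ?thesis by (simp add: cinner_self)
  qed
  have fixP: "P x = x" if "x \<in> L" for x by (rule eqI) (use P that P' in auto)
  have sa: "cinner (P x) y = cinner x (P y)" for x y
    using P(2) [OF P(1), of x y] P' [OF P(1), of x y] by simp
  have "bounded_clinear P"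
  proof (rule bounded_clinearI [of _ 1])
    show "P (x + y) = P x + P y" for x y
      by (rule eqI) (use P(1) L(2) in \<open>simp_all add: P' cinner_simps complex_vec.subspace_add\<close>)
    show "P (c *\<^sub>C x) = c *\<^sub>C P x" for c x
      by (rule eqI) (use P(1) L(2) in \<open>simp_all add: P' cinner_simps complex_vec.subspace_scale\<close>)
    show "norm (P x) \<le> norm x * 1" for x
    proof -
      have "(norm (P x + (x - P x)))\<^sup>2 = (norm (P x))\<^sup>2 + (norm (x - P x))\<^sup>2"
        by (intro pythagoras) (simp add: cinner_simps P(2) [OF P(1), of x x])
      then have "(norm (P x))\<^sup>2 \<le> (norm x)\<^sup>2" by simp
      then have "norm (P x) \<le> norm x" by (rule power2_le_imp_le) simp
      then show ?thesis by simp
    qed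
  qed
  then have "orth_proj P" by (intro orth_projI) (auto simp: self_adj_def sa fixP P(1))
  moreover have "range P = L" using P(1) fixP by (metis subsetI subset_antisym image_subset_iff rangeI)
  ultimately show ?thesis using that P' by (simp add: cinner_simps)
qed

lemma self_adj_op_Re:
  assumes "bounded_clinear T" shows "self_adj (op_Re T)"
  unfolding self_adj_def op_Re_def
  by (auto intro!: bounded_clinear_scaleC bounded_clinear_add bounded_clinear_hadjoint assms
      simp: cinner_simps cinner_hadjoint [OF assms])
    (metis cinner_commute cinner_hadjoint [OF assms] add.commute)

lemma op_Re_form:
  assumes "bounded_clinear T" shows "Re (cinner (op_Re T x) x) = Re (cinner (T x) x)"
proof -
  have "Re (cinner (hadjoint T x) x) = Re (cinner (T x) x)"
    by (subst Re_cinner_commute) (simp add: cinner_hadjoint [OF assms])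
  then show ?thesis by (simp add: op_Re_def cinner_simps)
qed

section \<open>Convexity of the numerical range\<close>

text \<open>After an affine change of the operator the two given values are 0 and 1. Rotating \<open>x\<close> makes the sum of the
  two mixed terms real, so along the segment from \<open>x\<close> to \<open>y\<close> the normalised form is a
  continuous real function from 0 to 1 and takes every value between. The subspace \<open>M\<close> allows the
  lemma to be used for compressions.\<close>

lemma toeplitz_hausdorff:
  assumes T: "bounded_clinear T" and M: "csubspace M"
  shows "convex {cinner (T x) x | x. x \<in> M \<and> norm x = 1}" (is "convex ?W")
proof (rule convexI)
  fix p q :: complex and t' t :: real
  assume pq: "p \<in> ?W" "q \<in> ?W" and t: "0 \<le> t'" "0 \<le> t" "t' + t = 1"
  obtain x where x: "x \<in> M" "norm x = 1" "cinner (T x) x = p" using pq(1) by auto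
  obtain y where y: "y \<in> M" "norm y = 1" "cinner (T y) y = q" using pq(2) by auto
  show "t' *\<^sub>R p + t *\<^sub>R q \<in> ?W"
  proof (cases "p = q")
    case True
    then have "t' *\<^sub>R p + t *\<^sub>R q = p" using t(3) by (simp flip: scaleR_left_distrib)
    with pq(1) show ?thesis by simp
  next
    case False
    \<comment> \<open>the affine change of \<open>T\<close> whose form is 0 at \<open>x\<close> and 1 at \<open>y\<close>\<close>
    define R where "R v = (1 / (q - p)) *\<^sub>C (T v - p *\<^sub>C v)" for v
    have R: "bounded_clinear R"
      unfolding R_def by (intro bounded_clinear_scaleC bounded_clinear_diff T bounded_clinear_ident)
    have R_form: "cinner (T v) v = p + (q - p) * cinner (R v) v" if "norm v = 1" for v
    proof -
      have "cinner (R v) v = (cinner (T v) v - p) / (q - p)"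
        using that by (simp add: R_def cinner_simps cinner_self)
      with False show ?thesis by simp
    qed
    have Rx: "cinner (R x) x = 0" and Ry: "cinner (R y) y = 1"
      using False x y by (simp_all add: R_def cinner_simps cinner_self)
    define a where "a = cinner (R x) y"
    define b where "b = cinner (R y) x"
    \<comment> \<open>This choice of \<open>u\<close> makes \<open>u a + cnj u b\<close> real, since its imaginary part is that of \<open>u (a - cnj b)\<close>.\<close>
    obtain u where u: "cmod u = 1" "u * (a - cnj b) = complex_of_real (cmod (a - cnj b))"
      by (rule complex_polar)
    define g where "g = Re (u * a + cnj u * b)"
    have "Im (u * a + cnj u * b) = Im (u * (a - cnj b))" by (simp add: algebra_simps)
    then have g: "u * a + cnj u * b = complex_of_real g"
      using u by (simp add: g_def complex_eq_iff)
    define z where "z s = (1 - s) *\<^sub>R (u *\<^sub>C x) + s *\<^sub>R y" for s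
    have uu: "u * cnj u = 1"
      using u(1) complex_norm_square [of u] by simp
    have Rz: "cinner (R (z s)) (z s) = complex_of_real (s\<^sup>2 + s * (1 - s) * g)" for s
    proof -
      have "cinner (R (z s)) (z s) = complex_of_real (1 - s) * complex_of_real (1 - s) * (u * cnj u) * cinner (R x) x
          + complex_of_real s * complex_of_real s * cinner (R y) y
          + complex_of_real s * complex_of_real (1 - s) * (u * a + cnj u * b)"
        by (simp add: z_def a_def b_def scaleR_eq_scaleC bounded_clinearD(2,3,4) [OF R]
            cinner_simps algebra_simps)
      then show ?thesis by (simp add: Rx Ry g power2_eq_square)
    qed
    have z0: "z s \<noteq> 0" for s
    proof
      assume zs: "z s = 0"
      then have eq: "(1 - s) *\<^sub>R (u *\<^sub>C x) = - (s *\<^sub>R y)" by (simp add: z_def eq_neg_iff_add_eq_0)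
      have "cinner (R ((1 - s) *\<^sub>R (u *\<^sub>C x))) ((1 - s) *\<^sub>R (u *\<^sub>C x)) = 0"
        by (simp add: scaleR_eq_scaleC bounded_clinearD(2) [OF R] cinner_simps Rx)
      moreover have "cinner (R (- (s *\<^sub>R y))) (- (s *\<^sub>R y)) = complex_of_real (s * s)"
        by (simp add: scaleR_eq_scaleC bounded_clinearD(2,6) [OF R] cinner_simps Ry)
      ultimately have "s = 0" using eq by simp
      then have "norm (u *\<^sub>C x) = 0" using zs by (simp add: z_def)
      then show False using u x by (simp add: norm_scaleC)
    qed
    define \<phi> where "\<phi> s = (s\<^sup>2 + s * (1 - s) * g) / (norm (z s))\<^sup>2" for s
    have "continuous_on {0..1} \<phi>"
      unfolding \<phi>_def z_def using z0 unfolding z_def by (intro continuous_intros) auto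
    moreover have "\<phi> 0 \<le> t" "t \<le> \<phi> 1" using t y by (simp_all add: \<phi>_def z_def)
    ultimately obtain s where s: "\<phi> s = t" using IVT' [of \<phi> 0 t 1] by auto
    define v where "v = complex_of_real (1 / norm (z s)) *\<^sub>C z s"
    have v: "norm v = 1" using z0 [of s] by (simp add: v_def norm_scaleC norm_divide)
    have "cinner (R v) v = complex_of_real (\<phi> s)"
      unfolding v_def form_scaleC [OF R] Rz
      by (simp add: \<phi>_def power_divide norm_divide)
    then have "cinner (T v) v = p + (q - p) * complex_of_real t" using R_form [OF v] s by simp
    also have "\<dots> = t' *\<^sub>R p + t *\<^sub>R q"
    proof -
      have t': "t' = 1 - t" using t(3) by simp
      show ?thesis unfolding t' by (simp add: scaleR_conv_of_real algebra_simps)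
    qed
    finally have "cinner (T v) v = t' *\<^sub>R p + t *\<^sub>R q" .
    moreover have "v \<in> M" using x(1) y(1) M
      unfolding v_def z_def scaleR_eq_scaleC
      by (intro complex_vec.subspace_scale complex_vec.subspace_add)
    ultimately show ?thesis using v by force
  qed
qed

section \<open>Orthonormal sequences that diagonalise a form\<close>

text \<open>Vectors are chosen one after the other, each orthogonal to \<open>w\<close>, \<open>T w\<close> and \<open>T\<^sup>* w\<close> for every earlier \<open>w\<close>.
  The adjoint takes care of the entries \<open>\<langle>T w\<^sub>m, w\<^sub>n\<rangle>\<close> with \<open>n < m\<close>.\<close>

lemma diagonalising_sequence:
  assumes T: "bounded_clinear T"
    and step: "\<And>B. finite B \<Longrightarrow> \<exists>w. norm w = 1 \<and> w \<in> ortho B \<and> Q w"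
  obtains w :: "nat \<Rightarrow> 'a::complex_hilbert"
  where "\<And>n. norm (w n) = 1" "\<And>n. Q (w n)" "\<And>m n. m \<noteq> n \<Longrightarrow> cinner (w m) (w n) = 0"
    "\<And>m n. m \<noteq> n \<Longrightarrow> cinner (T (w m)) (w n) = 0"
proof -
  obtain f where f: "\<And>B. finite B \<Longrightarrow> norm (f B) = 1" "\<And>B. finite B \<Longrightarrow> f B \<in> ortho B"
      "\<And>B. finite B \<Longrightarrow> Q (f B)"
    using step by metis
  define G where "G B = B \<union> {f B, T (f B), hadjoint T (f B)}" for B
  define Bs where "Bs n = (G ^^ n) {}" for n
  define w where "w n = f (Bs n)" for n
  have fin: "finite (Bs n)" for n
    by (induction n) (simp_all add: Bs_def G_def)
  have Suc: "Bs (Suc n) = Bs n \<union> {w n, T (w n), hadjoint T (w n)}" for n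
    by (simp add: Bs_def w_def G_def)
  have mono: "Bs m \<subseteq> Bs n" if "m \<le> n" for m n
    using that by (rule lift_Suc_mono_le [of Bs, rotated]) (auto simp: Suc)
  have earlier: "cinner (w n) (w m) = 0" "cinner (w n) (T (w m)) = 0" "cinner (T (w n)) (w m) = 0"
    if "m < n" for m n
  proof -
    have "{w m, T (w m), hadjoint T (w m)} \<subseteq> Bs n"
      using mono [of "Suc m" n] that by (auto simp: Suc)
    moreover have "w n \<in> ortho (Bs n)" unfolding w_def by (rule f(2) [OF fin])
    ultimately show "cinner (w n) (w m) = 0" "cinner (w n) (T (w m)) = 0" "cinner (T (w n)) (w m) = 0"
      by (auto simp: ortho_def cinner_hadjoint [OF T])
  qed
  show ?thesis
  proof
    show "norm (w n) = 1" "Q (w n)" for n by (simp_all add: w_def f fin)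
    fix m n :: nat assume "m \<noteq> n"
    then have "m < n \<or> n < m" by auto
    then show "cinner (w m) (w n) = 0" "cinner (T (w m)) (w n) = 0"
      using earlier [of m n] earlier [of n m] cinner_eq_zero_commute by blast+
  qed
qed

section \<open>The positive part of a form that is negative on a space of finite codimension\<close>

text \<open>Compactness of the unit ball of a finite-dimensional space, expressed through
  coordinates because the topology of the ambient type is not locally compact.\<close>

lemma subsequence_finite_coordinates:
  fixes x :: "nat \<Rightarrow> 'a::complex_hilbert"
  assumes "finite B" "\<And>n. norm (x n) \<le> 1"
  obtains r :: "nat \<Rightarrow> nat" where "strict_mono r" "\<And>b. b \<in> B \<Longrightarrow> convergent (\<lambda>n. cinner (x (r n)) b)"
proof -
  have "\<exists>r::nat \<Rightarrow> nat. strict_mono r \<and> (\<forall>b\<in>B. convergent (\<lambda>n. cinner (x (r n)) b))"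
    using assms(1)
  proof induction
    case empty
    show ?case by (rule exI [of _ id]) (simp add: strict_mono_def)
  next
    case (insert b B)
    then obtain r where r: "strict_mono r" "\<And>b. b \<in> B \<Longrightarrow> convergent (\<lambda>n. cinner (x (r n)) b)"
      by blast
    have "norm (cinner (x (r n)) b) \<le> norm b" for n
      using cmod_cinner_le [of "x (r n)" b] assms(2) [of "r n"]
        mult_right_mono [of "norm (x (r n))" 1 "norm b"] by simp
    then have "bounded (range (\<lambda>n. cinner (x (r n)) b))" by (intro boundedI) auto
    then obtain l s where s: "strict_mono s" "((\<lambda>n. cinner (x (r n)) b) \<circ> s) \<longlonglongrightarrow> l"
      using bounded_imp_convergent_subsequence by blast
    show ?case
    proof (rule exI [of _ "r \<circ> s"], intro conjI ballI)
      show "strict_mono (r \<circ> s)" using r(1) s(1) by (rule strict_mono_o)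
      fix c assume c: "c \<in> insert b B"
      show "convergent (\<lambda>n. cinner (x ((r \<circ> s) n)) c)"
      proof (cases "c = b")
        case True
        with s(2) show ?thesis by (auto simp: convergent_def comp_def)
      next
        case False
        with c r(2) have "convergent (\<lambda>n. cinner (x (r n)) c)" by auto
        from convergent_subseq_convergent [OF this s(1)] show ?thesis by (simp add: comp_def)
      qed
    qed
  qed
  then show ?thesis using that by blast
qed

text \<open>The Cauchy-Schwarz inequality for the semi-inner product \<open>\<langle>D x, y\<rangle>\<close>, applied with \<open>y = D x\<close>. It shows that a
  positive operator is small where its form is small.\<close>

lemma positive_form_bound:
  assumes D: "self_adj D" and M: "csubspace M" "\<And>x. x \<in> M \<Longrightarrow> D x \<in> M"
    and nonneg: "\<And>x. x \<in> M \<Longrightarrow> 0 \<le> Re (cinner (D x) x)" and x: "x \<in> M"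
  shows "(norm (D x))\<^sup>2 \<le> onorm D * Re (cinner (D x) x)"
proof (cases "D x = 0")
  case False
  let ?L = "onorm D" and ?y = "D x"
  have bD: "bounded_clinear D" by (rule self_adjD(1) [OF D])
  have L: "?L > 0"
    using False norm_le_onorm [OF bD, of x] onorm_pos_le [OF bounded_clinearD(1) [OF bD]]
    by (cases "?L = 0") auto
  \<comment> \<open>the step at which the upper bound for the form at \<open>x - t D x\<close> is least\<close>
  define t where "t = 1 / ?L"
  have "0 \<le> Re (cinner (D (x - complex_of_real t *\<^sub>C ?y)) (x - complex_of_real t *\<^sub>C ?y))"
    using M x by (intro nonneg complex_vec.subspace_diff complex_vec.subspace_scale)
  also have "\<dots> = Re (cinner ?y x) - 2 * t * (norm ?y)\<^sup>2 + t * t * Re (cinner (D ?y) ?y)"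
    using self_adjD(2) [OF D, of ?y x]
    by (simp add: bounded_clinearD(2,4) [OF bD] cinner_simps Re_cinner_self algebra_simps)
  also have "\<dots> \<le> Re (cinner ?y x) - 2 * t * (norm ?y)\<^sup>2 + t * t * (?L * (norm ?y)\<^sup>2)"
    using order_trans [OF complex_Re_le_cmod cmod_form_le [OF bD]]
    by (intro add_left_mono mult_left_mono) (auto simp: t_def)
  also have "\<dots> = Re (cinner ?y x) - (norm ?y)\<^sup>2 / ?L"
    using L by (simp add: t_def field_simps)
  finally show ?thesis using L by (simp add: field_simps)
qed (simp add: cinner_simps)

text \<open>The supremum \<open>m\<close> of the form over the unit sphere of \<open>M\<close> is positive, and it is attained. For a
  maximising sequence \<open>(m - K) x\<^sub>n\<close> tends to 0. Some subsequence has converging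
  components in the span of \<open>B\<close>; in the directions orthogonal to \<open>B\<close> the operator \<open>m - K\<close> is bounded below by
  \<open>m\<close>, which makes the remaining components Cauchy as well.\<close>

lemma positive_eigenvector:
  assumes K: "self_adj K" and B: "finite B" and neg: "\<And>x. x \<in> ortho B \<Longrightarrow> Re (cinner (K x) x) \<le> 0"
    and M: "closed M" "csubspace M" "\<And>x. x \<in> M \<Longrightarrow> K x \<in> M"
    and x0: "x0 \<in> M" "Re (cinner (K x0) x0) > 0"
  obtains u \<kappa> where "u \<in> M" "norm u = 1" "\<kappa> > 0" "K u = complex_of_real \<kappa> *\<^sub>C u"
proof -
  define q where "q x = Re (cinner (K x) x)" for x
  have bK: "bounded_clinear K" by (rule self_adjD(1) [OF K])
  have q_scale: "q (complex_of_real c *\<^sub>C x) = c\<^sup>2 * q x" for c x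
    by (simp add: q_def form_scaleC [OF bK] flip: of_real_power)
  obtain C where C: "finite C" "orthonormal_set C" "B \<subseteq> cspan C" "C \<subseteq> cspan B" "card C \<le> card B"
    by (rule gram_schmidt [OF B])
  define m where "m = Sup (q ` {x \<in> M. norm x = 1})"
  have bdd: "bdd_above (q ` {x \<in> M. norm x = 1})"
    using order_trans [OF complex_Re_le_cmod cmod_form_le [OF bK]]
    by (intro bdd_aboveI2 [of _ _ "onorm K"]) (simp add: q_def, metis mult.right_neutral power_one)
  have q_le: "q x \<le> m * (norm x)\<^sup>2" if "x \<in> M" for x
  proof (cases "x = 0")
    case True
    then show ?thesis by (simp add: q_def cinner_simps)
  next
    case False
    have "q (complex_of_real (1 / norm x) *\<^sub>C x) \<le> m"
      unfolding m_def using False that M(2)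
      by (intro cSup_upper bdd) (auto simp: norm_scaleC norm_divide intro!: complex_vec.subspace_scale)
    then show ?thesis using False unfolding q_scale by (simp add: field_simps)
  qed
  have m: "m > 0"
  proof (rule ccontr)
    assume "\<not> m > 0"
    then have "m * (norm x0)\<^sup>2 \<le> 0" by (simp add: mult_nonpos_nonneg)
    with q_le [OF x0(1)] x0(2) show False by (simp add: q_def)
  qed
  have "\<exists>x\<in>M. norm x = 1 \<and> q x > m - inverse (real (Suc n))" for n
  proof -
    have ne: "q ` {x \<in> M. norm x = 1} \<noteq> {}"
    proof -
      have "x0 \<noteq> 0" using x0(2) by (auto simp: cinner_simps)
      then have "complex_of_real (1 / norm x0) *\<^sub>C x0 \<in> {x \<in> M. norm x = 1}"
        using x0(1) M(2) by (auto simp: norm_scaleC norm_divide intro!: complex_vec.subspace_scale)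
      then show ?thesis by blast
    qed
    have "m - inverse (real (Suc n)) < Sup (q ` {x \<in> M. norm x = 1})" by (simp add: m_def)
    then show ?thesis using less_cSup_iff [OF ne bdd] by auto
  qed
  then obtain x where x: "\<And>n. x n \<in> M" "\<And>n. norm (x n) = 1"
      "\<And>n. q (x n) > m - inverse (real (Suc n))" by metis
  define D where "D x = complex_of_real m *\<^sub>C x - K x" for x
  have D: "self_adj D"
    using bounded_clinear_diff [OF bounded_clinear_scaleC [OF bounded_clinear_ident] bK]
    by (simp add: D_def [abs_def] self_adj_def cinner_simps self_adjD(2) [OF K])
  have bD: "bounded_clinear D" by (rule self_adjD(1) [OF D])
  have D_form: "Re (cinner (D x) x) = m * (norm x)\<^sup>2 - q x" for x
    by (simp add: D_def q_def cinner_simps Re_cinner_self)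
  have DM: "D x \<in> M" if "x \<in> M" for x
    unfolding D_def using that M(2,3) by (intro complex_vec.subspace_diff complex_vec.subspace_scale)
  have D_small: "(norm (D (x n)))\<^sup>2 \<le> onorm D * inverse (real (Suc n))" for n
  proof -
    have "(norm (D (x n)))\<^sup>2 \<le> onorm D * Re (cinner (D (x n)) (x n))"
      by (rule positive_form_bound [OF D M(2) DM _ x(1)]) (simp_all add: D_form q_le)
    also have "\<dots> \<le> onorm D * inverse (real (Suc n))"
      using x(3) [of n] by (intro mult_left_mono onorm_pos_le bounded_clinearD(1) [OF bD])
        (simp add: D_form x(2))
    finally show ?thesis .
  qed
  have Dx: "(\<lambda>n. norm (D (x n))) \<longlonglongrightarrow> 0"
  proof -
    have lim: "(\<lambda>n. onorm D * inverse (real (Suc n))) \<longlonglongrightarrow> 0"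
      by (rule tendsto_mult_right_zero [OF LIMSEQ_inverse_real_of_nat])
    have "(\<lambda>n. (norm (D (x n)))\<^sup>2) \<longlonglongrightarrow> 0"
      by (rule tendsto_sandwich [OF _ _ tendsto_const lim]) (use D_small in \<open>auto simp del: of_nat_Suc\<close>)
    then have "(\<lambda>n. sqrt ((norm (D (x n)))\<^sup>2)) \<longlonglongrightarrow> sqrt 0" by (intro tendsto_real_sqrt)
    then show ?thesis by simp
  qed
  obtain r where r: "strict_mono r" "\<And>b. b \<in> C \<Longrightarrow> convergent (\<lambda>n. cinner (x (r n)) b)"
    using subsequence_finite_coordinates [OF C(1), of x] x(2) by (metis order_refl)
  define z where "z n = x (r n)" for n
  have z: "z n \<in> M" "norm (z n) = 1" for n by (simp_all add: z_def x)
  have Dz: "(\<lambda>n. norm (D (z n))) \<longlonglongrightarrow> 0"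
    using LIMSEQ_subseq_LIMSEQ [OF Dx r(1)] by (simp add: comp_def z_def)
  have "convergent (\<lambda>n. fproj C (z n))"
  proof -
    obtain l where l: "\<And>b. b \<in> C \<Longrightarrow> (\<lambda>n. cinner (z n) b) \<longlonglongrightarrow> l b"
      using r(2) unfolding convergent_def z_def by metis
    have "(\<lambda>n. fproj C (z n)) \<longlonglongrightarrow> (\<Sum>b\<in>C. l b *\<^sub>C b)"
      unfolding fproj_def
      by (intro tendsto_sum bounded_bilinear.tendsto [OF bounded_bilinear_scaleC] l tendsto_const)
    then show ?thesis by (auto simp: convergent_def)
  qed
  then have Cp: "Cauchy (\<lambda>n. fproj C (z n))" by (rule convergent_Cauchy)
  \<comment> \<open>With \<open>y = z\<^sub>k - z\<^sub>l\<close>, the identity \<open>m \<parallel>y\<parallel>\<^sup>2 = \<langle>D y, y\<rangle> + \<langle>K y, y\<rangle>\<close> is estimated termwise: the form of \<open>K\<close>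
    is nonpositive apart from the terms that involve \<open>fproj C y\<close>.\<close>
  have key: "m * (norm (z k - z l))\<^sup>2 \<le> 2 * (norm (D (z k)) + norm (D (z l)))
      + 6 * (onorm K * norm (fproj C (z k) - fproj C (z l)))" for k l
  proof -
    define y where "y = z k - z l"
    define v where "v = fproj C y"
    have ny: "norm y \<le> 2" using norm_triangle_ineq4 [of "z k" "z l"] by (simp add: y_def z)
    have nv: "norm v \<le> norm y" unfolding v_def by (rule norm_fproj_le [OF C(1,2)])
    have K0: "onorm K \<ge> 0" by (rule onorm_pos_le [OF bounded_clinearD(1) [OF bK]])
    have "y - v \<in> ortho B"
      unfolding v_def using diff_fproj_ortho [OF C(1,2)] ortho_antimono_cspan [OF C(3)] by blast
    then have "q (y - v) \<le> 0" unfolding q_def by (rule neg)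
    moreover have "q y = q (y - v) + Re (cinner (K v) y) + Re (cinner (K (y - v)) v)"
      by (simp add: q_def bounded_clinearD(4) [OF bK] cinner_simps)
    moreover have "Re (cinner (K v) y) \<le> onorm K * norm v * norm y"
      by (intro order_trans [OF complex_Re_le_cmod] order_trans [OF cmod_cinner_le]
          mult_right_mono norm_le_onorm bK) simp
    moreover have "Re (cinner (K (y - v)) v) \<le> onorm K * norm (y - v) * norm v"
      by (intro order_trans [OF complex_Re_le_cmod] order_trans [OF cmod_cinner_le]
          mult_right_mono norm_le_onorm bK) simp
    moreover have "onorm K * norm v * norm y \<le> onorm K * norm v * 2"
      using ny K0 by (intro mult_left_mono) auto
    moreover have "onorm K * norm (y - v) * norm v \<le> onorm K * 4 * norm v"
      using ny nv K0 norm_triangle_ineq4 [of y v]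
      by (intro mult_right_mono mult_left_mono) auto
    ultimately have qy: "q y \<le> 6 * (onorm K * norm v)" by linarith
    have "m * (norm y)\<^sup>2 - q y = Re (cinner (D y) y)" by (simp add: D_form)
    also have "\<dots> \<le> norm (D y) * norm y"
      using cmod_cinner_le complex_Re_le_cmod order_trans by blast
    also have "\<dots> \<le> (norm (D (z k)) + norm (D (z l))) * 2"
      using ny norm_triangle_ineq4 [of "D (z k)" "D (z l)"]
      by (intro mult_mono) (auto simp: y_def bounded_clinearD(4) [OF bD])
    finally have "m * (norm y)\<^sup>2 \<le> 2 * (norm (D (z k)) + norm (D (z l))) + 6 * (onorm K * norm v)"
      using qy by linarith
    moreover have "v = fproj C (z k) - fproj C (z l)"
      by (simp add: v_def y_def bounded_clinearD(4) [OF bounded_clinear_fproj [OF C(1,2)]])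
    ultimately show ?thesis by (simp add: y_def)
  qed
  have "Cauchy z"
  proof (rule metric_CauchyI)
    fix e :: real assume e: "0 < e"
    define c where "c = m * e\<^sup>2"
    have c: "c > 0" using m e by (simp add: c_def)
    have K0: "onorm K \<ge> 0" by (rule onorm_pos_le [OF bounded_clinearD(1) [OF bK]])
    obtain N1 where N1: "\<And>n. n \<ge> N1 \<Longrightarrow> norm (D (z n)) < c / 8"
      using LIMSEQ_D [OF Dz, of "c / 8"] c by auto
    obtain N2 where N2: "\<And>k l. k \<ge> N2 \<Longrightarrow> l \<ge> N2 \<Longrightarrow>
        norm (fproj C (z k) - fproj C (z l)) < c / (12 * (onorm K + 1))"
      using metric_CauchyD [OF Cp, of "c / (12 * (onorm K + 1))"] c K0
      by (auto simp: dist_norm)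
    have "dist (z k) (z l) < e" if "k \<ge> max N1 N2" "l \<ge> max N1 N2" for k l
    proof -
      have "onorm K * norm (fproj C (z k) - fproj C (z l)) \<le> onorm K * (c / (12 * (onorm K + 1)))"
        using N2 [of k l] that K0 by (intro mult_left_mono) auto
      also have "\<dots> \<le> c / 12"
        using c K0 by (simp add: field_simps)
      finally have "m * (norm (z k - z l))\<^sup>2 < c"
        using key [of k l] N1 [of k] N1 [of l] that by simp
      then have "(norm (z k - z l))\<^sup>2 < e\<^sup>2" using m by (simp add: c_def)
      then show ?thesis using e by (simp add: dist_norm power_less_imp_less_base)
    qed
    then show "\<exists>N. \<forall>k\<ge>N. \<forall>l\<ge>N. dist (z k) (z l) < e" by blast
  qed
  then obtain u where u: "z \<longlonglongrightarrow> u" using Cauchy_convergent convergent_def by blast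
  have uM: "u \<in> M" using M(1) z(1) u by (meson closed_sequentially)
  have "(\<lambda>n. norm (z n)) \<longlonglongrightarrow> norm u" by (intro tendsto_norm u)
  then have nu: "norm u = 1" by (simp add: z(2) LIMSEQ_const_iff)
  have "(\<lambda>n. norm (D (z n))) \<longlonglongrightarrow> norm (D u)"
    by (intro tendsto_norm bounded_linear.tendsto [OF bounded_clinearD(1) [OF bD]] u)
  then have "norm (D u) = 0" using Dz LIMSEQ_unique by blast
  then have "K u = complex_of_real m *\<^sub>C u" by (simp add: D_def)
  with uM nu m show ?thesis by (rule that)
qed

lemma eigenvectors_ortho_invariant:
  assumes K: "self_adj K" and E: "\<And>e. e \<in> E \<Longrightarrow> \<exists>\<kappa>. K e = complex_of_real \<kappa> *\<^sub>C e"
    and x: "x \<in> ortho E"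
  shows "K x \<in> ortho E"
  unfolding ortho_def
proof safe
  fix e assume e: "e \<in> E"
  then obtain \<kappa> where "K e = complex_of_real \<kappa> *\<^sub>C e" using E by blast
  with e x show "cinner (K x) e = 0"
    by (simp add: self_adjD(2) [OF K] cinner_simps ortho_def)
qed

lemma diagonal_form:
  assumes T: "bounded_clinear T" and E: "finite E"
    and diag: "\<And>e f. e \<in> E \<Longrightarrow> f \<in> E \<Longrightarrow> e \<noteq> f \<Longrightarrow> cinner (T e) f = 0"
  shows "cinner (T (\<Sum>e\<in>E. a e *\<^sub>C e)) (\<Sum>e\<in>E. a e *\<^sub>C e)
    = (\<Sum>e\<in>E. complex_of_real ((cmod (a e))\<^sup>2) * cinner (T e) e)"
proof -
  have "cinner (T (\<Sum>e\<in>E. a e *\<^sub>C e)) (\<Sum>e\<in>E. a e *\<^sub>C e)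
      = (\<Sum>f\<in>E. \<Sum>e\<in>E. a e * cnj (a f) * cinner (T e) f)"
    by (simp add: bounded_clinear_sum [OF T] bounded_clinearD(2) [OF T] cinner_sum_left
        cinner_sum_right cinner_simps sum_distrib_left mult_ac)
  also have "\<dots> = (\<Sum>f\<in>E. \<Sum>e\<in>E. if e = f then a f * cnj (a f) * cinner (T f) f else 0)"
    using diag by (intro sum.cong refl) auto
  also have "\<dots> = (\<Sum>e\<in>E. complex_of_real ((cmod (a e))\<^sup>2) * cinner (T e) e)"
    using E by (simp add: complex_norm_square del: of_real_power)
  finally show ?thesis .
qed

text \<open>An orthonormal set of eigenvectors with positive eigenvalues has at most \<open>card B\<close> elements, since its span
  carries a positive form and so cannot meet \<open>ortho B\<close>. Take such a set of greatest size:
  a positive value of the form on its orthogonal complement would produce another eigenvector by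
  \<open>positive_eigenvector\<close>.\<close>

lemma finite_positive_part:
  assumes K: "self_adj K" and B: "finite B" and neg: "\<And>x. x \<in> ortho B \<Longrightarrow> Re (cinner (K x) x) \<le> 0"
  obtains E where "finite E" "orthonormal_set E" "\<And>e. e \<in> E \<Longrightarrow> \<exists>\<kappa>>0. K e = complex_of_real \<kappa> *\<^sub>C e"
    "\<And>x. x \<in> ortho E \<Longrightarrow> Re (cinner (K x) x) \<le> 0"
proof -
  define good where "good E \<longleftrightarrow> finite E \<and> orthonormal_set E \<and> (\<forall>e\<in>E. \<exists>\<kappa>>0. K e = complex_of_real \<kappa> *\<^sub>C e)" for E
  have card_le: "card E \<le> card B" if E': "good E" for E
  proof (rule ccontr)
    assume "\<not> card E \<le> card B"
    have E: "finite E" "orthonormal_set E" using E' by (auto simp: good_def)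
    have diag: "cinner (K e) f = 0" if "e \<in> E" "f \<in> E" "e \<noteq> f" for e f
      using E' that by (auto simp: good_def orthonormal_set_def cinner_simps)
    have pos: "Re (cinner (K e) e) > 0" if "e \<in> E" for e
      using E' that by (auto simp: good_def orthonormal_set_def cinner_simps)
    obtain x where x: "x \<in> cspan E" "x \<noteq> 0" "x \<in> ortho B"
      by (rule ortho_meets_span [OF orthonormal_set_independent [OF E(2)] E(1) B])
        (use \<open>\<not> card E \<le> card B\<close> in simp)
    obtain a where a: "x = (\<Sum>e\<in>E. a e *\<^sub>C e)"
      using x(1) complex_vec.span_finite [OF E(1)] by auto
    with x(2) obtain f where f: "f \<in> E" "a f \<noteq> 0"
      by (metis (no_types, lifting) complex_vec.scale_zero_left sum.neutral)
    have "0 < (\<Sum>e\<in>E. (cmod (a e))\<^sup>2 * Re (cinner (K e) e))"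
      using E(1) f pos by (intro sum_pos2 [of _ f]) (auto intro!: mult_nonneg_nonneg intro: less_imp_le)
    also have "\<dots> = Re (cinner (K x) x)"
      using diagonal_form [OF self_adjD(1) [OF K] E(1) diag, of a] by (simp add: a del: of_real_power)
    finally show False using neg [OF x(3)] by simp
  qed
  have "good {}" by (simp add: good_def orthonormal_set_def)
  then have "\<exists>E. good E \<and> (\<forall>E'. good E' \<longrightarrow> card E' \<le> card E)"
    by (rule ex_has_greatest_nat [of _ _ _ "Suc (card B)"]) (use card_le in \<open>simp add: le_SucI less_Suc_eq_le\<close>)
  then obtain E where E: "good E" "\<And>E'. good E' \<Longrightarrow> card E' \<le> card E" by blast
  show ?thesis
  proof
    show fin: "finite E" and ons: "orthonormal_set E" and eig: "\<And>e. e \<in> E \<Longrightarrow> \<exists>\<kappa>>0. K e = complex_of_real \<kappa> *\<^sub>C e"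
      using E(1) by (auto simp: good_def)
    fix x assume x: "x \<in> ortho E"
    show "Re (cinner (K x) x) \<le> 0"
    proof (rule ccontr)
      assume "\<not> Re (cinner (K x) x) \<le> 0"
      then have pos: "Re (cinner (K x) x) > 0" by simp
      have inv: "K y \<in> ortho E" if "y \<in> ortho E" for y
        by (rule eigenvectors_ortho_invariant [OF K _ that]) (use eig in blast)
      obtain u \<kappa> where u: "u \<in> ortho E" "norm u = 1" "\<kappa> > 0" "K u = complex_of_real \<kappa> *\<^sub>C u"
        using positive_eigenvector [OF K B neg closed_ortho csubspace_ortho inv x pos] by blast
      then have "good (insert u E)"
        using fin eig orthonormal_set_insert(1) [OF ons u(2,1)] by (auto simp: good_def)
      moreover have "u \<notin> E" by (rule orthonormal_set_insert(2) [OF ons u(2,1)])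
      ultimately show False using E(2) [of "insert u E"] fin by simp
    qed
  qed
qed

text \<open>The span of eigenvectors and its orthogonal complement are both invariant, so there are no cross terms.\<close>

lemma form_split:
  assumes H: "self_adj H" and E: "finite E" "orthonormal_set E"
    and eig: "\<And>e. e \<in> E \<Longrightarrow> \<exists>\<kappa>. H e = complex_of_real \<kappa> *\<^sub>C e"
  shows "Re (cinner (H x) x) = Re (cinner (H (fproj E x)) (fproj E x))
    + Re (cinner (H (x - fproj E x)) (x - fproj E x))"
proof -
  let ?p = "fproj E x" and ?w = "x - fproj E x"
  have w: "?w \<in> ortho E" by (rule diff_fproj_ortho [OF E])
  have "cinner (H ?w) ?p = 0"
    by (rule ortho_cspan(1) [OF eigenvectors_ortho_invariant [OF H eig w] fproj_in_cspan])
  then have *: "cinner (H ?w) ?p = 0" "cinner (H ?p) ?w = 0"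
    using self_adjD(2) [OF H, of ?p ?w] cinner_eq_zero_commute by auto
  have "cinner (H (?p + ?w)) (?p + ?w) = cinner (H ?p) ?p + cinner (H ?w) ?w"
    unfolding bounded_clinearD(3) [OF self_adjD(1) [OF H]] cinner_add_left cinner_add_right * by simp
  then show ?thesis by simp
qed

section \<open>Eigenvalues of compressions\<close>

text \<open>A finite set imposes fewer conditions than there are independent vectors in \<open>L\<close>.\<close>

lemma unit_vector_in_ortho:
  assumes L: "csubspace L" "\<not> cfinite_dim L" and B: "finite B"
  shows "\<exists>w. norm w = 1 \<and> w \<in> ortho B \<and> w \<in> L"
proof -
  obtain C where C: "C \<subseteq> L" "complex_vec.independent C" "L \<subseteq> cspan C"
    by (rule complex_vec.basis_exists)
  have "infinite C" using C(3) L(2) unfolding cfinite_dim_def by blast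
  then obtain D where D: "finite D" "card D = Suc (card B)" "D \<subseteq> C"
    using infinite_arbitrarily_large by blast
  obtain x where x: "x \<in> cspan D" "x \<noteq> 0" "x \<in> ortho B"
    by (rule ortho_meets_span [OF complex_vec.independent_mono [OF C(2) D(3)] D(1) B])
      (simp add: D)
  have "cspan D \<subseteq> L"
    using C(1) D(3) by (intro complex_vec.span_minimal L) blast
  then have "complex_of_real (1 / norm x) *\<^sub>C x \<in> ortho B \<inter> L"
    using x L csubspace_ortho by (auto intro: complex_vec.subspace_scale)
  moreover have "norm (complex_of_real (1 / norm x) *\<^sub>C x) = 1"
    using x by (simp add: norm_scaleC norm_divide)
  ultimately show ?thesis by blast
qed

lemma orthonormal_sequence_in:
  assumes L: "csubspace L" "\<not> cfinite_dim L"
  obtains w :: "nat \<Rightarrow> 'a::complex_hilbert"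
  where "\<And>n. norm (w n) = 1" "\<And>n. w n \<in> L" "\<And>m n. m \<noteq> n \<Longrightarrow> cinner (w m) (w n) = 0"
  by (rule diagonalising_sequence [OF bounded_clinear_ident unit_vector_in_ortho [OF L]], assumption, rule that)

text \<open>Compressions are indexed by families, whereas projections are built on sets; this predicate, in the form of
  \<open>compression_id_eq_1_iff\<close>, is the bridge between the two.\<close>

definition orthonormal_family :: "nat \<Rightarrow> (nat \<Rightarrow> 'a::complex_hilbert) \<Rightarrow> bool" where
  "orthonormal_family k X \<longleftrightarrow> (\<forall>i<k. \<forall>j<k. cinner (X i) (X j) = (if i = j then 1 else 0))"

lemma compression_id_eq_1_iff: "compression k X id = 1\<^sub>m k \<longleftrightarrow> orthonormal_family k X"
  unfolding compression_def orthonormal_family_def mat_eq_iff by auto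

lemma orthonormal_family_of_sequence:
  "(\<And>n. norm (w n) = 1) \<Longrightarrow> (\<And>m n. m \<noteq> n \<Longrightarrow> cinner (w m) (w n) = 0) \<Longrightarrow> orthonormal_family k w"
  by (auto simp: orthonormal_family_def cinner_self_eq_1_iff)

lemma orthonormal_familyD:
  assumes "orthonormal_family k X"
  shows "orthonormal_set (X ` {..<k})" "inj_on X {..<k}" "card (X ` {..<k}) = k"
proof -
  show inj: "inj_on X {..<k}"
  proof (rule inj_onI)
    fix i j assume "i \<in> {..<k}" "j \<in> {..<k}" "X i = X j"
    with assms show "i = j"
      by (metis lessThan_iff orthonormal_family_def zero_neq_one)
  qed
  then show "card (X ` {..<k}) = k" by (simp add: card_image)
  show "orthonormal_set (X ` {..<k})"
    using assms inj by (auto simp: orthonormal_set_def orthonormal_family_def inj_on_def)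
qed

lemma fproj_family:
  "orthonormal_family k X \<Longrightarrow> fproj (X ` {..<k}) x = (\<Sum>i<k. cinner x (X i) *\<^sub>C X i)"
  unfolding fproj_def by (subst sum.reindex) (simp_all add: orthonormal_familyD)

lemma compression_mult_vec:
  assumes T: "bounded_clinear T" and i: "i < k" and v: "v \<in> carrier_vec k"
  shows "vec_index (compression k X T *\<^sub>v v) i = cinner (T (\<Sum>j<k. vec_index v j *\<^sub>C X j)) (X i)"
proof -
  have "vec_index (compression k X T *\<^sub>v v) i = (\<Sum>j<k. cinner (T (X j)) (X i) * vec_index v j)"
    using i v by (simp add: compression_def scalar_prod_def lessThan_atLeast0)
  also have "\<dots> = cinner (T (\<Sum>j<k. vec_index v j *\<^sub>C X j)) (X i)"
    by (simp add: bounded_clinear_sum [OF T] bounded_clinearD(2) [OF T] cinner_sum_left cinner_simps mult.commute)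
  finally show ?thesis .
qed

text \<open>The compression is the matrix, in the orthonormal basis \<open>X\<close>, of \<open>T\<close> followed by the projection onto the span of
  \<open>X\<close>. Eigenvalues can therefore be treated inside the Hilbert space.\<close>

lemma eigenvalue_compression_iff:
  assumes T: "bounded_clinear T" and X: "orthonormal_family k X"
  shows "eigenvalue (compression k X T) z \<longleftrightarrow>
    (\<exists>u \<in> cspan (X ` {..<k}). u \<noteq> 0 \<and> fproj (X ` {..<k}) (T u) = z *\<^sub>C u)"
    (is "?lhs \<longleftrightarrow> ?rhs")
proof -
  let ?E = "X ` {..<k}"
  have E: "finite ?E" "orthonormal_set ?E" using orthonormal_familyD [OF X] by auto
  have dim: "dim_row (compression k X T) = k" by (simp add: compression_def)
  have coeff: "cinner (\<Sum>j<k. a j *\<^sub>C X j) (X i) = a i" if i: "i < k" for a i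
  proof -
    have "cinner (\<Sum>j<k. a j *\<^sub>C X j) (X i) = (\<Sum>j<k. if j = i then a j else 0)"
      unfolding cinner_sum_left using X i
      by (intro sum.cong refl) (auto simp: cinner_simps orthonormal_family_def)
    with i show ?thesis by simp
  qed
  show ?thesis
  proof
    assume ?lhs
    then obtain v where v: "v \<in> carrier_vec k" "v \<noteq> 0\<^sub>v k" "compression k X T *\<^sub>v v = z \<cdot>\<^sub>v v"
      by (auto simp: eigenvalue_def eigenvector_def dim)
    define u where "u = (\<Sum>j<k. vec_index v j *\<^sub>C X j)"
    have "u \<in> cspan ?E"
      unfolding u_def by (intro complex_vec.span_sum complex_vec.span_scale complex_vec.span_base) auto
    moreover have "u \<noteq> 0"
    proof
      assume "u = 0"
      then have "vec_index v i = 0" if "i < k" for i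
        using coeff [OF that, of "vec_index v"] by (simp add: u_def cinner_simps)
      with v(1,2) show False by auto
    qed
    moreover have "fproj ?E (T u) = z *\<^sub>C u"
    proof -
      have "cinner (T u) (X i) = z * vec_index v i" if "i < k" for i
        using compression_mult_vec [OF T that v(1), of X] v(1,3) that by (simp add: u_def)
      then show ?thesis
        by (simp add: fproj_family [OF X] u_def complex_vec.scale_sum_right scaleC_scaleC)
    qed
    ultimately show ?rhs by blast
  next
    assume ?rhs
    then obtain u where u: "u \<in> cspan ?E" "u \<noteq> 0" "fproj ?E (T u) = z *\<^sub>C u" by blast
    define v where "v = Matrix.vec k (\<lambda>i. cinner u (X i))"
    have "u = fproj ?E u" using fproj_cspan [OF E u(1)] by simp
    also have "\<dots> = (\<Sum>j<k. vec_index v j *\<^sub>C X j)"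
      by (simp add: fproj_family [OF X] v_def)
    finally have u': "(\<Sum>j<k. vec_index v j *\<^sub>C X j) = u" ..
    have v: "v \<in> carrier_vec k" by (simp add: v_def)
    have "v \<noteq> 0\<^sub>v k" using u' u(2) by auto
    moreover have "compression k X T *\<^sub>v v = z \<cdot>\<^sub>v v"
    proof (rule eq_vecI)
      fix i assume "i < dim_vec (z \<cdot>\<^sub>v v)"
      then have i: "i < k" using v by simp
      have "vec_index (compression k X T *\<^sub>v v) i = cinner (T u) (X i)"
        using compression_mult_vec [OF T i v, of X] by (simp add: u')
      also have "\<dots> = cinner (T u) (fproj ?E (X i))"
        using i by (simp add: fproj_cspan [OF E] complex_vec.span_base)
      also have "\<dots> = cinner (z *\<^sub>C u) (X i)"
        by (simp add: fproj_symmetric [OF E, symmetric] u(3))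
      finally show "vec_index (compression k X T *\<^sub>v v) i = vec_index (z \<cdot>\<^sub>v v) i"
        using i by (simp add: v_def cinner_simps)
    qed (simp add: v_def dim)
    ultimately show ?lhs using v by (auto simp: eigenvalue_def eigenvector_def dim)
  qed
qed

text \<open>A \<open>k \<times> k\<close> matrix has exactly \<open>k\<close> eigenvalues with multiplicity, so the \<open>k\<close>-th largest is the last one in the
  decreasing list.\<close>

lemma kth_largest_eigenvalue_is_least:
  assumes M: "M \<in> carrier_mat k k" and k: "k \<ge> 1"
  shows "\<exists>z. eigenvalue M z \<and> Re z = kth_largest_eigenvalue k M"
    and "eigenvalue M z \<Longrightarrow> kth_largest_eigenvalue k M \<le> Re z"
proof -
  define ms where "ms = image_mset Re (proots (char_poly M))"
  define xs where "xs = sorted_list_of_multiset ms"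
  have deg: "degree (char_poly M) = k" using degree_monic_char_poly [OF M] by simp
  then have p: "char_poly M \<noteq> 0" using k by auto
  have len: "length xs = k"
    using mset_sorted_list_of_multiset [of ms]
    by (metis deg ms_def size_image_mset size_mset size_proots_complex xs_def)
  have set: "set xs = Re ` {z. eigenvalue M z}"
    using p by (auto simp: xs_def ms_def eigenvalue_root_char_poly [OF M])
  have "kth_largest_eigenvalue k M = rev xs ! (k - 1)"
    by (simp add: kth_largest_eigenvalue_def xs_def ms_def)
  also have "\<dots> = xs ! 0" using len k by (simp add: rev_nth)
  finally have kth: "kth_largest_eigenvalue k M = xs ! 0" .
  then have "kth_largest_eigenvalue k M \<in> set xs" using len k by simp
  then show "\<exists>z. eigenvalue M z \<and> Re z = kth_largest_eigenvalue k M" by (auto simp: set)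
  assume "eigenvalue M z"
  then have "Re z \<in> set xs" by (simp add: set)
  moreover have "sorted xs" by (simp add: xs_def)
  ultimately show "kth_largest_eigenvalue k M \<le> Re z"
    unfolding kth by (metis in_set_conv_nth le0 sorted_iff_nth_mono)
qed

lemma compression_carrier: "compression k X T \<in> carrier_mat k k"
  by (simp add: compression_def)

lemma compression_eigenvalue_is_rayleigh:
  assumes T: "bounded_clinear T" and X: "orthonormal_family k X" and k: "k \<ge> 1"
  obtains u where "u \<in> cspan (X ` {..<k})" "norm u = 1"
    "kth_largest_eigenvalue k (compression k X T) = Re (cinner (T u) u)"
proof -
  let ?E = "X ` {..<k}"
  have E: "finite ?E" "orthonormal_set ?E" using orthonormal_familyD [OF X] by auto
  obtain z where z: "eigenvalue (compression k X T) z"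
      "Re z = kth_largest_eigenvalue k (compression k X T)"
    using kth_largest_eigenvalue_is_least(1) [OF compression_carrier k] by blast
  obtain v where v: "v \<in> cspan ?E" "v \<noteq> 0" "fproj ?E (T v) = z *\<^sub>C v"
    using z(1) eigenvalue_compression_iff [OF T X] by blast
  have "cinner (T v) v = cinner (T v) (fproj ?E v)" by (simp add: fproj_cspan [OF E v(1)])
  also have "\<dots> = z * complex_of_real ((norm v)\<^sup>2)"
    by (simp add: fproj_symmetric [OF E, symmetric] v(3) cinner_simps cinner_self)
  finally have Tv: "cinner (T v) v = z * complex_of_real ((norm v)\<^sup>2)" .
  define u where "u = complex_of_real (1 / norm v) *\<^sub>C v"
  have "cinner (T u) u = z"
    unfolding u_def form_scaleC [OF T] Tv using v(2) by (simp add: norm_divide power_divide)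
  moreover have "norm u = 1" using v(2) by (simp add: u_def norm_scaleC norm_divide)
  moreover have "u \<in> cspan ?E" unfolding u_def by (rule complex_vec.span_scale [OF v(1)])
  ultimately show ?thesis using that z(2) by simp
qed

text \<open>The least eigenvalue \<open>c\<close> of a Hermitian matrix is a lower bound for its form. Otherwise \<open>P (c - H) P\<close>, with \<open>P\<close>
  the projection onto the span of \<open>X\<close>, has a positive value; being zero orthogonally to \<open>X\<close>, it has by
  \<open>positive_eigenvector\<close> a positive eigenvalue \<open>\<kappa>\<close>, and \<open>c - \<kappa>\<close> is a smaller eigenvalue of the
  compression.\<close>

lemma kth_largest_eigenvalue_le_form:
  assumes H: "self_adj H" and X: "orthonormal_family k X" and k: "k \<ge> 1"
    and u: "u \<in> cspan (X ` {..<k})"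
  shows "kth_largest_eigenvalue k (compression k X H) * (norm u)\<^sup>2 \<le> Re (cinner (H u) u)"
proof (rule ccontr)
  let ?E = "X ` {..<k}" and ?c = "kth_largest_eigenvalue k (compression k X H)"
  have E: "finite ?E" "orthonormal_set ?E" using orthonormal_familyD [OF X] by auto
  have bH: "bounded_clinear H" by (rule self_adjD(1) [OF H])
  note bP = bounded_clinear_fproj [OF E]
  assume "\<not> ?c * (norm u)\<^sup>2 \<le> Re (cinner (H u) u)"
  then have lt: "Re (cinner (H u) u) < ?c * (norm u)\<^sup>2" by simp
  define K where "K x = fproj ?E (complex_of_real ?c *\<^sub>C fproj ?E x - H (fproj ?E x))" for x
  have K: "self_adj K"
    unfolding self_adj_def
  proof (intro conjI allI)
    show "bounded_clinear K"
      unfolding K_def [abs_def]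
      by (intro bounded_clinear_compose [OF bP] bounded_clinear_diff bounded_clinear_scaleC bP
          bounded_clinear_compose [OF bH])
    show "cinner (K x) y = cinner x (K y)" for x y
    proof -
      have "cinner (K x) y = cinner (complex_of_real ?c *\<^sub>C fproj ?E x - H (fproj ?E x)) (fproj ?E y)"
        unfolding K_def by (rule fproj_symmetric [OF E])
      also have "\<dots> = cinner (fproj ?E x) (complex_of_real ?c *\<^sub>C fproj ?E y - H (fproj ?E y))"
        by (simp add: cinner_simps self_adjD(2) [OF H])
      also have "\<dots> = cinner x (K y)"
        unfolding K_def by (rule fproj_symmetric [OF E])
      finally show ?thesis .
    qed
  qed
  have neg: "Re (cinner (K x) x) \<le> 0" if "x \<in> ortho ?E" for x
    by (simp add: K_def fproj_ortho [OF that] bounded_clinearD(5) [OF bH] bounded_clinearD(5) [OF bP]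
        cinner_simps)
  have "cinner (K u) u = complex_of_real (?c * (norm u)\<^sup>2) - cinner (H u) u"
    by (simp add: K_def fproj_symmetric [OF E] fproj_cspan [OF E u] cinner_simps cinner_self)
  with lt have pos: "Re (cinner (K u) u) > 0" by simp
  obtain v \<kappa> where v: "norm v = 1" "\<kappa> > 0" "K v = complex_of_real \<kappa> *\<^sub>C v"
    using positive_eigenvector [OF K E(1) neg closed_UNIV complex_vec.subspace_UNIV UNIV_I UNIV_I pos]
    by blast
  have "v = complex_of_real (1 / \<kappa>) *\<^sub>C K v" using v by (simp add: scaleC_scaleC)
  also have "\<dots> \<in> cspan ?E" unfolding K_def by (intro complex_vec.span_scale fproj_in_cspan)
  finally have vE: "v \<in> cspan ?E" .
  have "K v = complex_of_real ?c *\<^sub>C v - fproj ?E (H v)"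
    by (simp add: K_def fproj_cspan [OF E vE] bounded_clinearD(2,4) [OF bP])
  then have "fproj ?E (H v) = complex_of_real (?c - \<kappa>) *\<^sub>C v"
    using v(3) by (simp add: complex_vec.scale_left_diff_distrib algebra_simps)
  moreover have "v \<noteq> 0" using v(1) by auto
  ultimately have "eigenvalue (compression k X H) (complex_of_real (?c - \<kappa>))"
    using eigenvalue_compression_iff [OF bH X] vE by blast
  from kth_largest_eigenvalue_is_least(2) [OF compression_carrier k this] v(2)
  show False by simp
qed

text \<open>The eigenvalue of a compression is a value of the form of \<open>T\<close>, so it is bounded by the norm of \<open>T\<close>; hence
  the supremum defining \<open>lambda_op\<close> is one of a set that is bounded above.\<close>

lemma lambda_op_ge:
  assumes T: "bounded_clinear T" and X: "orthonormal_family k X" and k: "k \<ge> 1"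
    and ge: "\<And>u. u \<in> cspan (X ` {..<k}) \<Longrightarrow> norm u = 1 \<Longrightarrow> c \<le> Re (cinner (T u) u)"
  shows "c \<le> lambda_op k T"
proof -
  have "kth_largest_eigenvalue k (compression k Y T) \<le> onorm T" if Y: "orthonormal_family k Y" for Y
  proof -
    obtain u where "norm u = 1" "kth_largest_eigenvalue k (compression k Y T) = Re (cinner (T u) u)"
      by (rule compression_eigenvalue_is_rayleigh [OF T Y k])
    then show ?thesis
      using order_trans [OF complex_Re_le_cmod cmod_form_le [OF T, of u]] by simp
  qed
  then have "bdd_above {kth_largest_eigenvalue k (compression k X T) | X. compression k X id = 1\<^sub>m k}"
    by (intro bdd_aboveI [of _ "onorm T"]) (auto simp: compression_id_eq_1_iff)
  then have "kth_largest_eigenvalue k (compression k X T) \<le> lambda_op k T"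
    unfolding lambda_op_def using X by (intro cSup_upper) (auto simp: compression_id_eq_1_iff)
  moreover have "c \<le> kth_largest_eigenvalue k (compression k X T)"
    by (rule compression_eigenvalue_is_rayleigh [OF T X k]) (use ge in simp)
  ultimately show ?thesis by simp
qed

text \<open>One vector with a small value in each \<open>k\<close>-dimensional space is enough, by \<open>kth_largest_eigenvalue_le_form\<close>.
  Infinite dimension guarantees that the supremum is not over the empty set.\<close>

lemma lambda_op_le:
  fixes H :: "'a::complex_hilbert \<Rightarrow> 'a"
  assumes inf: "\<not> cfinite_dim (UNIV :: 'a set)" and H: "self_adj H" and k: "k \<ge> 1"
    and le: "\<And>E. orthonormal_set E \<Longrightarrow> card E = k \<Longrightarrow> finite E \<Longrightarrow>
      \<exists>u\<in>cspan E. norm u = 1 \<and> Re (cinner (H u) u) \<le> s"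
  shows "lambda_op k H \<le> s"
  unfolding lambda_op_def
proof (rule cSup_least)
  obtain w :: "nat \<Rightarrow> 'a" where w: "\<And>n. norm (w n) = 1" "\<And>n. w n \<in> UNIV"
      "\<And>m n. m \<noteq> n \<Longrightarrow> cinner (w m) (w n) = 0"
    by (rule orthonormal_sequence_in [OF complex_vec.subspace_UNIV inf], rule that)
  have "orthonormal_family k w" by (rule orthonormal_family_of_sequence [OF w(1,3)])
  then show "{kth_largest_eigenvalue k (compression k X H) | X. compression k X id = 1\<^sub>m k} \<noteq> {}"
    by (auto simp: compression_id_eq_1_iff)
next
  fix x assume "x \<in> {kth_largest_eigenvalue k (compression k X H) | X. compression k X id = 1\<^sub>m k}"
  then obtain X where X: "orthonormal_family k X" "x = kth_largest_eigenvalue k (compression k X H)"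
    by (auto simp: compression_id_eq_1_iff)
  obtain u where u: "u \<in> cspan (X ` {..<k})" "norm u = 1" "Re (cinner (H u) u) \<le> s"
    using le [of "X ` {..<k}"] orthonormal_familyD [OF X(1)] by auto
  show "x \<le> s"
    using kth_largest_eigenvalue_le_form [OF H X(1) k u(1)] u(2,3) X(2) by simp
qed

section \<open>Higher rank numerical ranges\<close>

lemma finite_rank_opD:
  assumes "finite_rank_op F"
  obtains C where "bounded_clinear F" "finite C" "range F \<subseteq> cspan C"
  using assms that by (auto simp: finite_rank_op_def oprank_def cfinite_dim_def split: if_splits)

lemma oprank_fproj:
  assumes "finite E" "orthonormal_set E" shows "oprank (fproj E) = enat (card E)"
proof -
  have "cfinite_dim (range (fproj E))"
    using assms unfolding cfinite_dim_def range_fproj [OF assms] by blast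
  then show ?thesis
    by (simp add: oprank_def range_fproj [OF assms]
        complex_vec.dim_span_eq_card_independent [OF orthonormal_set_independent [OF assms(2)]] del: complex_vec.dim_span)
qed

lemma finite_rank_fproj: "finite E \<Longrightarrow> orthonormal_set E \<Longrightarrow> finite_rank_op (fproj E)"
  by (simp add: finite_rank_op_def bounded_clinear_fproj oprank_fproj)

lemma csubspace_range: "bounded_clinear T \<Longrightarrow> csubspace (range T)"
  unfolding complex_vec.subspace_def
  by (auto simp flip: bounded_clinearD(2,3)) (metis bounded_clinearD(5) rangeI)

lemma orth_proj_range: "orth_proj P \<Longrightarrow> x \<in> range P \<Longrightarrow> P x = x"
  using orth_projD(2) by auto

text \<open>The condition \<open>P T P = \<mu> P\<close> in terms of the form, which passes to smaller subspaces.\<close>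

lemma Lambda_compression_form:
  assumes P: "orth_proj P" and PTP: "P \<circ> T \<circ> P = (\<lambda>x. \<mu> *\<^sub>C P x)"
    and x: "x \<in> range P" and y: "y \<in> range P"
  shows "cinner (T x) y = \<mu> * cinner x y"
proof -
  have "cinner (T x) y = cinner (P (T (P x))) y"
    using orth_proj_range [OF P x] orth_proj_range [OF P y] self_adjD(2) [OF orth_projD(1) [OF P]]
    by simp
  also have "\<dots> = \<mu> * cinner x y"
    using fun_cong [OF PTP, of x] orth_proj_range [OF P x] by (simp add: cinner_simps)
  finally show ?thesis .
qed

lemma Lambda_infinity_subset: "Lambda \<infinity> T \<subseteq> Lambda (enat k) T"
proof
  fix \<mu> assume "\<mu> \<in> Lambda \<infinity> T"
  then obtain P where P: "orth_proj P" "oprank P = \<infinity>" "P \<circ> T \<circ> P = (\<lambda>x. \<mu> *\<^sub>C P x)"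
    by (auto simp: Lambda_def)
  have L: "csubspace (range P)"
    by (rule csubspace_range [OF self_adjD(1) [OF orth_projD(1) [OF P(1)]]])
  have inf: "\<not> cfinite_dim (range P)" using P(2) by (auto simp: oprank_def)
  obtain w :: "nat \<Rightarrow> 'a" where w: "\<And>n. norm (w n) = 1" "\<And>n. w n \<in> range P"
      "\<And>m n. m \<noteq> n \<Longrightarrow> cinner (w m) (w n) = 0"
    by (rule orthonormal_sequence_in [OF L inf], rule that)
  define E where "E = w ` {..<k}"
  have "orthonormal_family k w" by (rule orthonormal_family_of_sequence [OF w(1,3)])
  from orthonormal_familyD [OF this] have E: "finite E" "orthonormal_set E" "card E = k"
    by (simp_all add: E_def)
  have EL: "E \<subseteq> range P" using w(2) by (auto simp: E_def)
  then have spanL: "cspan E \<subseteq> range P" by (rule complex_vec.span_minimal [OF _ L])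
  have "fproj E (T (fproj E x)) = \<mu> *\<^sub>C fproj E x" for x
  proof -
    have x: "fproj E x \<in> range P" using fproj_in_cspan spanL by blast
    have "fproj E (T (fproj E x)) = (\<Sum>e\<in>E. \<mu> *\<^sub>C cinner (fproj E x) e *\<^sub>C e)"
      unfolding fproj_def [of E "T (fproj E x)"]
      using EL Lambda_compression_form [OF P(1,3) x]
      by (intro sum.cong refl) (auto simp: scaleC_scaleC)
    also have "\<dots> = \<mu> *\<^sub>C fproj E (fproj E x)"
      by (simp add: fproj_def [of E "fproj E x"] complex_vec.scale_sum_right)
    finally show ?thesis by (simp add: fproj_cspan [OF E(1,2) fproj_in_cspan])
  qed
  then show "\<mu> \<in> Lambda (enat k) T"
    using orth_proj_fproj [OF E(1,2)] oprank_fproj [OF E(1,2)] E(3)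
    by (auto simp: Lambda_def fun_eq_iff intro!: exI [of _ "fproj E"])
qed

lemma num_range_eq: "num_range T = {cinner (T x) x | x. norm x = 1}"
  by (simp add: num_range_def cinner_self_eq_1_iff)

text \<open>For \<open>k\<close> above the rank of \<open>F\<close> the range of the projection contains a unit vector that \<open>F\<close> kills, and there \<open>A + F\<close>
  has the value \<open>\<mu>\<close>.\<close>

lemma Lambda_finite_in_num_range:
  assumes F: "finite_rank_op F" and \<mu>: "\<And>k. k \<ge> 1 \<Longrightarrow> \<mu> \<in> Lambda (enat k) A"
  shows "\<mu> \<in> num_range (\<lambda>x. A x + F x)"
proof -
  obtain C where bF: "bounded_clinear F" and C: "finite C" "range F \<subseteq> cspan C"
    by (rule finite_rank_opD [OF F])
  obtain P where P: "orth_proj P" "oprank P = enat (Suc (card C))" "P \<circ> A \<circ> P = (\<lambda>x. \<mu> *\<^sub>C P x)"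
    using \<mu> [of "Suc (card C)"] by (auto simp: Lambda_def)
  have L: "csubspace (range P)"
    by (rule csubspace_range [OF self_adjD(1) [OF orth_projD(1) [OF P(1)]]])
  obtain B where B: "B \<subseteq> range P" "complex_vec.independent B" "range P \<subseteq> cspan B" "card B = cdim (range P)"
    by (rule complex_vec.basis_exists)
  have card: "card B = Suc (card C)"
    using P(2) B(4) by (auto simp: oprank_def split: if_splits)
  then have "finite B" by (metis card.infinite nat.distinct(1))
  obtain x where x: "x \<in> cspan B" "x \<noteq> 0" "F x = 0"
    by (rule kernel_meets_span [OF B(2) \<open>finite B\<close> C(1) _ bounded_clinearD(7) [OF bF]])
      (use card C(2) in auto)
  define u where "u = complex_of_real (1 / norm x) *\<^sub>C x"
  have u: "norm u = 1" using x by (simp add: u_def norm_scaleC norm_divide)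
  have Fu: "F u = 0" by (simp add: u_def bounded_clinearD(2) [OF bF] x)
  have "x \<in> range P" using complex_vec.span_minimal [OF B(1) L] x(1) by blast
  then have "u \<in> range P" unfolding u_def by (rule complex_vec.subspace_scale [OF L])
  then have "cinner (A u + F u) u = \<mu>"
    using Lambda_compression_form [OF P(1,3), of u u] u by (simp add: Fu cinner_self)
  with u show ?thesis unfolding num_range_eq by blast
qed

text \<open>The hypothesis yields an orthonormal sequence with \<open>\<langle>A w\<^sub>m, w\<^sub>n\<rangle> = \<delta>\<^sub>m\<^sub>n \<mu>\<close>. The projection is taken onto the double
  orthogonal complement of the sequence, which is closed by construction; the identity
  \<open>\<langle>A u, y\<rangle> = \<mu> \<langle>u, y\<rangle>\<close> extends to it from the sequence, first in \<open>y\<close> and then, through the adjoint, in \<open>u\<close>.\<close>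

lemma Lambda_infinityI:
  assumes A: "bounded_clinear A"
    and step: "\<And>B. finite B \<Longrightarrow> \<exists>w. norm w = 1 \<and> w \<in> ortho B \<and> cinner (A w) w = \<mu>"
  shows "\<mu> \<in> Lambda \<infinity> A"
proof -
  obtain w :: "nat \<Rightarrow> 'a" where w: "\<And>n. norm (w n) = 1" "\<And>n. cinner (A (w n)) (w n) = \<mu>"
    "\<And>m n. m \<noteq> n \<Longrightarrow> cinner (w m) (w n) = 0"
    "\<And>m n. m \<noteq> n \<Longrightarrow> cinner (A (w m)) (w n) = 0"
    by (rule diagonalising_sequence [OF A step], assumption, rule that)
  define N where "N = ortho (range w)"
  define L where "L = ortho N"
  have wL: "w n \<in> L" for n
    using cinner_eq_zero_commute by (auto simp: L_def N_def ortho_def)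
  obtain P where P: "orth_proj P" "range P = L"
    using orth_proj_onto_closed [of L] unfolding L_def using closed_ortho csubspace_ortho by metis
  have "infinite (range w)"
  proof (rule range_inj_infinite, rule injI)
    fix m n assume "w m = w n"
    then show "m = n" using w(1) [of n] w(3) [of m n] by (auto simp: cinner_self)
  qed
  moreover have ons: "orthonormal_set (range w)"
    unfolding orthonormal_set_def
  proof safe
    fix m n
    show "cinner (w m) (w n) = (if w m = w n then 1 else 0)"
      using w(1) [of m] w(3) [of m n] by (cases "m = n") (auto simp: cinner_self)
  qed
  ultimately have "\<not> cfinite_dim L"
    unfolding cfinite_dim_def using complex_vec.independent_span_bound [OF _ orthonormal_set_independent [OF ons]] wL
    by (metis image_subset_iff subset_trans image_subsetI)
  then have rank: "oprank P = \<infinity>" by (simp add: oprank_def P(2))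
  have Aw: "A (w n) - \<mu> *\<^sub>C w n \<in> N" for n
    unfolding N_def ortho_def
  proof safe
    fix m
    show "cinner (A (w n) - \<mu> *\<^sub>C w n) (w m) = 0"
      using w(1) [of n] w(2) [of n] w(3,4) [of n m]
      by (cases "m = n") (simp_all add: cinner_simps cinner_self)
  qed
  have PAP: "cinner (A u - \<mu> *\<^sub>C u) y = 0" if u: "u \<in> L" and y: "y \<in> L" for u y
  proof -
    have "hadjoint A y - cnj \<mu> *\<^sub>C y \<in> N"
      unfolding N_def ortho_def
    proof safe
      fix n
      have "cinner (A (w n) - \<mu> *\<^sub>C w n) y = 0"
        using y Aw [of n] cinner_eq_zero_commute by (auto simp: L_def ortho_def)
      then have "cinner (w n) (hadjoint A y - cnj \<mu> *\<^sub>C y) = 0"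
        by (simp add: cinner_simps cinner_hadjoint [OF A])
      then show "cinner (hadjoint A y - cnj \<mu> *\<^sub>C y) (w n) = 0"
        by (simp add: cinner_eq_zero_commute)
    qed
    then have "cinner u (hadjoint A y - cnj \<mu> *\<^sub>C y) = 0"
      using u by (auto simp: L_def ortho_def)
    then show ?thesis by (simp add: cinner_simps cinner_hadjoint [OF A])
  qed
  have "P (A (P x)) = \<mu> *\<^sub>C P x" for x
  proof (rule cinner_ext)
    fix y
    have L: "P x \<in> L" "P y \<in> L" using P(2) by auto
    note sa = self_adjD(2) [OF orth_projD(1) [OF P(1)]]
    have "cinner y (P (A (P x))) = cinner (P y) (A (P x))" by (simp add: sa)
    also have "\<dots> = cinner (P y) (\<mu> *\<^sub>C P x)"
      using PAP [OF L] cinner_eq_zero_commute [of "A (P x) - \<mu> *\<^sub>C P x"] by (simp add: cinner_simps)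
    also have "\<dots> = cinner y (\<mu> *\<^sub>C P x)"
      by (simp add: cinner_simps sa orth_projD(2) [OF P(1)])
    finally show "cinner y (P (A (P x))) = cinner y (\<mu> *\<^sub>C P x)" .
  qed
  with P(1) rank show ?thesis by (auto simp: Lambda_def fun_eq_iff)
qed

section \<open>Pushing the top of a form down\<close>

lemma unit_complex_cis:
  assumes "cmod u = 1" obtains \<xi> where "\<xi> \<in> {0..<2*pi}" "cis \<xi> = u"
proof
  show "Arg2pi u \<in> {0..<2*pi}" using Arg2pi [of u] by auto
  show "cis (Arg2pi u) = u" using assms complex_norm_eq_1_exp [of u] by (simp add: cis_conv_exp)
qed

text \<open>Translates the half-planes given by separation theorems into those in the definition of \<open>Omega\<close>. The minus sign
  turns lower bounds for the inner product into upper bounds for the rotated real part.\<close>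

lemma inner_as_rotation:
  assumes "d \<noteq> 0"
  obtains \<xi> where "\<xi> \<in> {0..<2*pi}" "\<And>z. inner d z = - cmod d * Re (cis \<xi> * z)"
proof -
  have "cmod (- cnj d / complex_of_real (cmod d)) = 1" using assms by (simp add: norm_divide)
  then obtain \<xi> where \<xi>: "\<xi> \<in> {0..<2*pi}" "cis \<xi> = - cnj d / complex_of_real (cmod d)"
    by (rule unit_complex_cis)
  have "inner d z = - cmod d * Re (cis \<xi> * z)" for z
    unfolding \<xi>(2) using assms by (simp add: inner_complex_def field_simps)
  with \<xi>(1) show ?thesis by (rule that)
qed

definition rotated_Re :: "real \<Rightarrow> ('a::complex_hilbert \<Rightarrow> 'a) \<Rightarrow> 'a \<Rightarrow> 'a" where
  "rotated_Re \<xi> A = op_Re (\<lambda>x. cis \<xi> *\<^sub>C A x)"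

lemma rotated_Re:
  assumes "bounded_clinear A"
  shows "self_adj (rotated_Re \<xi> A)"
    "Re (cinner (rotated_Re \<xi> A x) x) = Re (cis \<xi> * cinner (A x) x)"
    "\<bar>Re (cinner (rotated_Re \<xi> A x) x)\<bar> \<le> onorm A * (norm x)\<^sup>2"
proof -
  note b = bounded_clinear_scaleC [OF assms, of "cis \<xi>"]
  show "self_adj (rotated_Re \<xi> A)" unfolding rotated_Re_def by (rule self_adj_op_Re [OF b])
  show *: "Re (cinner (rotated_Re \<xi> A x) x) = Re (cis \<xi> * cinner (A x) x)"
    unfolding rotated_Re_def op_Re_form [OF b] by (simp add: cinner_simps)
  show "\<bar>Re (cinner (rotated_Re \<xi> A x) x)\<bar> \<le> onorm A * (norm x)\<^sup>2"
    unfolding * using abs_Re_le_cmod [of "cis \<xi> * cinner (A x) x"] cmod_form_le [OF assms, of x]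
    by (simp add: norm_mult)
qed

lemma self_adj_shift: "self_adj H \<Longrightarrow> self_adj (\<lambda>x. H x - complex_of_real c *\<^sub>C x)"
  by (simp add: self_adj_def bounded_clinear_diff bounded_clinear_scaleC bounded_clinear_ident cinner_simps)

lemma shift_form: "Re (cinner (H x - complex_of_real c *\<^sub>C x) x) = Re (cinner (H x) x) - c * (norm x)\<^sup>2"
  by (simp add: cinner_simps cinner_self)

text \<open>On the span of \<open>E\<close> the form of the rotated operator is at most \<open>\<parallel>A\<parallel>\<close>, so subtracting \<open>2\<parallel>A\<parallel>\<close> brings it down
  to at most \<open>- \<parallel>A\<parallel>\<close>; orthogonally to the span it is at most \<open>c\<close> by assumption, and there are no cross terms. The defect
  \<open>(\<parallel>A\<parallel> + c) \<parallel>P x\<parallel>\<^sup>2\<close> is nonnegative as soon as \<open>c \<ge> - \<parallel>A\<parallel>\<close>, and when \<open>c > - \<parallel>A\<parallel>\<close> it shows that the value \<open>c\<close> forces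
  \<open>P x = 0\<close>, where \<open>P = fproj E\<close>.\<close>

lemma perturbed_form_le:
  assumes A: "bounded_clinear A" and E: "finite E" "orthonormal_set E"
    and eig: "\<And>e. e \<in> E \<Longrightarrow> \<exists>\<kappa>. rotated_Re \<xi> A e = complex_of_real \<kappa> *\<^sub>C e"
    and \<eta>: "cis \<eta> = - cnj (cis \<xi>)" and x: "norm x = 1"
    and below: "\<And>w. w \<in> ortho E \<Longrightarrow> Re (cinner (rotated_Re \<xi> A w) w) \<le> c * (norm w)\<^sup>2"
  shows "Re (cis \<xi> * cinner (A x + (2 * cis \<eta> * complex_of_real (onorm A)) *\<^sub>C fproj E x) x)
    \<le> c - (onorm A + c) * (norm (fproj E x))\<^sup>2"
proof -
  let ?H = "rotated_Re \<xi> A" and ?p = "fproj E x" and ?w = "x - fproj E x" and ?a = "onorm A"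
  have unit: "cis \<xi> * cis \<eta> = -1"
    unfolding \<eta> by (simp add: cis_cnj cis_mult)
  have px: "cinner ?p x = complex_of_real ((norm ?p)\<^sup>2)"
    using fproj_symmetric [OF E, of ?p x] by (simp add: fproj_cspan [OF E fproj_in_cspan] cinner_self)
  have "cis \<xi> * cinner (A x + (2 * cis \<eta> * complex_of_real ?a) *\<^sub>C ?p) x
      = cis \<xi> * cinner (A x) x + (cis \<xi> * cis \<eta>) * complex_of_real (2 * ?a * (norm ?p)\<^sup>2)"
    by (simp add: cinner_simps px algebra_simps)
  then have "Re (cis \<xi> * cinner (A x + (2 * cis \<eta> * complex_of_real ?a) *\<^sub>C ?p) x)
      = Re (cinner (?H x) x) - 2 * ?a * (norm ?p)\<^sup>2"
    unfolding unit by (simp add: rotated_Re(2) [OF A])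
  also have "Re (cinner (?H x) x) = Re (cinner (?H ?p) ?p) + Re (cinner (?H ?w) ?w)"
    by (rule form_split [OF rotated_Re(1) [OF A] E eig])
  also have "Re (cinner (?H ?p) ?p) \<le> ?a * (norm ?p)\<^sup>2"
    using rotated_Re(3) [OF A, of \<xi> ?p] by simp
  also have "Re (cinner (?H ?w) ?w) \<le> c * (norm ?w)\<^sup>2"
    by (rule below [OF diff_fproj_ortho [OF E]])
  also have "(norm ?w)\<^sup>2 = 1 - (norm ?p)\<^sup>2"
  proof -
    have "(norm (?p + ?w))\<^sup>2 = (norm ?p)\<^sup>2 + (norm ?w)\<^sup>2"
      by (rule pythagoras [OF ortho_cspan(2) [OF diff_fproj_ortho [OF E] fproj_in_cspan]])
    then show ?thesis using x by simp
  qed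
  finally show ?thesis by (simp add: algebra_simps)
qed

section \<open>The essential numerical range\<close>

text \<open>If \<open>\<lambda>\<^sub>k(H) < c < Re (e\<^sup>i\<^sup>\<xi> \<mu>)\<close>, one suitable perturbation moves the whole numerical range into the closed half-plane
  \<open>Re (e\<^sup>i\<^sup>\<xi> z) \<le> c\<close>, which does not contain \<open>\<mu>\<close>.\<close>

lemma closure_num_range_subset_Omega:
  fixes A :: "'a::complex_hilbert \<Rightarrow> 'a"
  assumes inf: "\<not> cfinite_dim (UNIV :: 'a set)" and A: "bounded_clinear A" and k: "k \<ge> 1"
    and \<mu>: "\<And>\<eta> E. \<eta> \<in> {0..<2*pi} \<Longrightarrow> finite E \<Longrightarrow> orthonormal_set E \<Longrightarrow>
      \<mu> \<in> closure (num_range (\<lambda>x. A x + (2 * cis \<eta> * complex_of_real (onorm A)) *\<^sub>C fproj E x))"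
  shows "\<mu> \<in> Omega k A"
  unfolding Omega_def
proof (intro INT_I CollectI)
  fix \<xi> :: real
  let ?H = "rotated_Re \<xi> A" and ?a = "onorm A"
  note H = rotated_Re [OF A, of \<xi>]
  note bH = self_adjD(1) [OF H(1)]
  show "Re (cis \<xi> * \<mu>) \<le> lambda_op k (op_Re (\<lambda>x. cis \<xi> *\<^sub>C A x))"
    unfolding rotated_Re_def [symmetric]
  proof (rule ccontr)
    assume "\<not> Re (cis \<xi> * \<mu>) \<le> lambda_op k ?H"
    then have "lambda_op k ?H < Re (cis \<xi> * \<mu>)" by (simp only: not_le)
    from dense [OF this] obtain c where c: "lambda_op k ?H < c" "c < Re (cis \<xi> * \<mu>)" by blast
    define K where "K x = ?H x - complex_of_real c *\<^sub>C x" for x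
    have K: "self_adj K" unfolding K_def [abs_def] by (rule self_adj_shift [OF H(1)])
    have K_form: "Re (cinner (K x) x) = Re (cinner (?H x) x) - c * (norm x)\<^sup>2" for x
      unfolding K_def by (rule shift_form)
    \<comment> \<open>Otherwise a diagonal compression with entries above \<open>c\<close> would force \<open>\<lambda>\<^sub>k(H) \<ge> c\<close>.\<close>
    have "\<exists>B. finite B \<and> (\<forall>x\<in>ortho B. Re (cinner (K x) x) \<le> 0)"
    proof (rule ccontr)
      assume no: "\<nexists>B. finite B \<and> (\<forall>x\<in>ortho B. Re (cinner (K x) x) \<le> 0)"
      have step: "\<exists>w. norm w = 1 \<and> w \<in> ortho B \<and> c < Re (cinner (?H w) w)" if B: "finite B" for B
      proof -
        obtain x where x: "x \<in> ortho B" "Re (cinner (K x) x) > 0"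
          using no B by (meson not_less)
        then have nz: "x \<noteq> 0" by (auto simp: cinner_simps)
        let ?w = "complex_of_real (1 / norm x) *\<^sub>C x"
        have nw: "norm ?w = 1" using nz by (simp add: norm_scaleC norm_divide)
        have "Re (cinner (K ?w) ?w) = (1 / norm x)\<^sup>2 * Re (cinner (K x) x)"
          unfolding form_scaleC [OF self_adjD(1) [OF K]]
          by (simp add: norm_divide del: of_real_power)
        also have "\<dots> > 0" using x nz by simp
        finally have "c < Re (cinner (?H ?w) ?w)" using nw by (simp add: K_form)
        with nw complex_vec.subspace_scale [OF csubspace_ortho x(1)] show ?thesis by blast
      qed
      obtain w :: "nat \<Rightarrow> 'a" where w: "\<And>n. norm (w n) = 1" "\<And>n. c < Re (cinner (?H (w n)) (w n))"
        "\<And>m n. m \<noteq> n \<Longrightarrow> cinner (w m) (w n) = 0"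
        "\<And>m n. m \<noteq> n \<Longrightarrow> cinner (?H (w m)) (w n) = 0"
        by (rule diagonalising_sequence [OF bH step], assumption, rule that)
      have fam: "orthonormal_family k w" by (rule orthonormal_family_of_sequence [OF w(1,3)])
      have "c \<le> Re (cinner (?H u) u)" if u: "u \<in> cspan (w ` {..<k})" "norm u = 1" for u
      proof -
        obtain a where a: "u = (\<Sum>e\<in>w ` {..<k}. a e *\<^sub>C e)"
          using u(1) complex_vec.span_finite [of "w ` {..<k}"] by auto
        have orth: "cinner e f = 0" "cinner (?H e) f = 0"
          if ef: "e \<in> w ` {..<k}" "f \<in> w ` {..<k}" "e \<noteq> f" for e f
        proof -
          obtain m n where mn: "e = w m" "f = w n" using ef(1,2) by blast
          with ef(3) have "m \<noteq> n" by blast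
          then show "cinner e f = 0" "cinner (?H e) f = 0" unfolding mn by (rule w(3), rule w(4))
        qed
        have "cinner u u = (\<Sum>e\<in>w ` {..<k}. complex_of_real ((cmod (a e))\<^sup>2) * cinner e e)"
          unfolding a by (rule diagonal_form [OF bounded_clinear_ident]) (auto simp: orth)
        also have "\<dots> = complex_of_real (\<Sum>e\<in>w ` {..<k}. (cmod (a e))\<^sup>2)"
          unfolding of_real_sum
          by (intro sum.cong refl) (use w(1) in \<open>auto simp: cinner_self simp del: of_real_power\<close>)
        finally have sum1: "(\<Sum>e\<in>w ` {..<k}. (cmod (a e))\<^sup>2) = 1"
          using u(2) by (simp add: cinner_self del: of_real_power of_real_sum)
        have "c = (\<Sum>e\<in>w ` {..<k}. (cmod (a e))\<^sup>2 * c)"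
          by (simp add: sum1 flip: sum_distrib_right)
        also have "\<dots> \<le> (\<Sum>e\<in>w ` {..<k}. (cmod (a e))\<^sup>2 * Re (cinner (?H e) e))"
          using w(2) by (intro sum_mono mult_left_mono) (auto intro: less_imp_le)
        also have "\<dots> = Re (cinner (?H u) u)"
          using diagonal_form [OF bH _ orth(2), of "w ` {..<k}" a] by (simp add: a del: of_real_power)
        finally show ?thesis .
      qed
      from lambda_op_ge [OF bH fam k this] c(1) show False by simp
    qed
    then obtain B where B: "finite B" "\<And>x. x \<in> ortho B \<Longrightarrow> Re (cinner (K x) x) \<le> 0" by blast
    obtain E where E: "finite E" "orthonormal_set E" "\<And>e. e \<in> E \<Longrightarrow> \<exists>\<kappa>>0. K e = complex_of_real \<kappa> *\<^sub>C e"
        "\<And>x. x \<in> ortho E \<Longrightarrow> Re (cinner (K x) x) \<le> 0"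
      by (rule finite_positive_part [OF K B], assumption, rule that)
    have eig: "\<exists>\<kappa>. ?H e = complex_of_real \<kappa> *\<^sub>C e" if e: "e \<in> E" for e
    proof -
      obtain \<kappa> where "K e = complex_of_real \<kappa> *\<^sub>C e" using E(3) [OF e] by blast
      then have "?H e = complex_of_real (\<kappa> + c) *\<^sub>C e"
        by (simp add: K_def scaleC_add_left diff_eq_eq)
      then show ?thesis by blast
    qed
    have ac: "0 \<le> ?a + c"
    proof -
      obtain w :: 'a where "norm w = 1" "w \<in> ortho B"
        using unit_vector_in_ortho [OF complex_vec.subspace_UNIV inf B(1)] by blast
      then show ?thesis using B(2) [of w] H(3) [of w] by (simp add: K_form)
    qed
    obtain \<eta> where \<eta>: "\<eta> \<in> {0..<2*pi}" "cis \<eta> = - cnj (cis \<xi>)"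
      by (rule unit_complex_cis [of "- cnj (cis \<xi>)"]) simp
    have "num_range (\<lambda>x. A x + (2 * cis \<eta> * complex_of_real ?a) *\<^sub>C fproj E x)
        \<subseteq> {z. Re (cis \<xi> * z) \<le> c}"
    proof
      fix z assume "z \<in> num_range (\<lambda>x. A x + (2 * cis \<eta> * complex_of_real ?a) *\<^sub>C fproj E x)"
      then obtain x where x: "norm x = 1"
        "z = cinner (A x + (2 * cis \<eta> * complex_of_real ?a) *\<^sub>C fproj E x) x"
        by (auto simp: num_range_eq)
      have "Re (cis \<xi> * z) \<le> c - (?a + c) * (norm (fproj E x))\<^sup>2"
        unfolding x(2) using E(4)
        by (intro perturbed_form_le [OF A E(1,2) eig \<eta>(2) x(1)]) (auto simp: K_form)
      also have "\<dots> \<le> c" using ac by simp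
      finally show "z \<in> {z. Re (cis \<xi> * z) \<le> c}" by simp
    qed
    moreover have "closed {z. Re (cis \<xi> * z) \<le> c}"
      by (intro closed_Collect_le continuous_intros)
    ultimately have "Re (cis \<xi> * \<mu>) \<le> c"
      using \<mu> [OF \<eta>(1) E(1,2)] closure_minimal by blast
    with c(2) show False by simp
  qed
qed

lemma convex_num_range: "bounded_clinear T \<Longrightarrow> convex (num_range T)"
  using toeplitz_hausdorff [OF _ complex_vec.subspace_UNIV, of T] by (simp add: num_range_eq)

text \<open>A half-plane separating \<open>\<mu>\<close> from the numerical range of \<open>A + F\<close> bounds \<open>\<lambda>\<^sub>k\<close> of the rotated real part of \<open>A\<close>, for
  \<open>k\<close> above the rank of \<open>F\<close>, because every \<open>k\<close>-dimensional space contains a unit vector on which \<open>A + F\<close> and \<open>A\<close> agree.\<close>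

lemma Omega_subset_closure_num_range:
  fixes A :: "'a::complex_hilbert \<Rightarrow> 'a"
  assumes inf: "\<not> cfinite_dim (UNIV :: 'a set)" and A: "bounded_clinear A"
    and F: "finite_rank_op F" and \<mu>: "\<And>k. k \<ge> 1 \<Longrightarrow> \<mu> \<in> Omega k A"
  shows "\<mu> \<in> closure (num_range (\<lambda>x. A x + F x))" (is "\<mu> \<in> closure ?W")
proof (rule ccontr)
  obtain C where bF: "bounded_clinear F" and C: "finite C" "range F \<subseteq> cspan C"
    by (rule finite_rank_opD [OF F])
  have conv: "convex ?W" by (rule convex_num_range [OF bounded_clinear_add [OF A bF]])
  assume "\<mu> \<notin> closure ?W"
  then obtain d b where d: "inner d \<mu> < b" "\<And>z. z \<in> closure ?W \<Longrightarrow> inner d z > b"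
    using separating_hyperplane_closed_point [OF convex_closure [OF conv] closed_closure] by metis
  obtain w :: 'a where "norm w = 1"
    using unit_vector_in_ortho [OF complex_vec.subspace_UNIV inf, of "{}"] by auto
  then have "cinner (A w + F w) w \<in> closure ?W"
    using closure_subset by (fastforce simp: num_range_eq)
  with d have "d \<noteq> 0" by force
  obtain \<xi> where \<xi>: "\<xi> \<in> {0..<2*pi}" "\<And>z. inner d z = - cmod d * Re (cis \<xi> * z)"
    by (rule inner_as_rotation [OF \<open>d \<noteq> 0\<close>], rule that)
  let ?H = "rotated_Re \<xi> A"
  define s where "s = - b / cmod d"
  have lt: "s < Re (cis \<xi> * \<mu>)" using d(1) \<open>d \<noteq> 0\<close> by (simp add: s_def \<xi>(2) field_simps)
  have W: "Re (cis \<xi> * z) \<le> s" if "z \<in> ?W" for z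
    using d(2) [of z] that closure_subset [of ?W] \<open>d \<noteq> 0\<close> by (auto simp: s_def \<xi>(2) field_simps)
  have "lambda_op (Suc (card C)) ?H \<le> s"
  proof (rule lambda_op_le [OF inf rotated_Re(1) [OF A]])
    fix E :: "'a set" assume E: "orthonormal_set E" "card E = Suc (card C)" "finite E"
    obtain x where x: "x \<in> cspan E" "x \<noteq> 0" "F x = 0"
      by (rule kernel_meets_span [OF orthonormal_set_independent [OF E(1)] E(3) C(1) _ bounded_clinearD(7) [OF bF]])
        (use E C(2) in auto)
    define u where "u = complex_of_real (1 / norm x) *\<^sub>C x"
    have u: "norm u = 1" using x by (simp add: u_def norm_scaleC norm_divide)
    have Fu: "F u = 0" by (simp add: u_def bounded_clinearD(2) [OF bF] x)
    have "cinner (A u) u \<in> ?W"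
      unfolding num_range_eq using u Fu by (auto intro!: exI [of _ u])
    then have "Re (cinner (?H u) u) \<le> s" using W by (simp add: rotated_Re(2) [OF A])
    moreover have "u \<in> cspan E" unfolding u_def by (rule complex_vec.span_scale [OF x(1)])
    ultimately show "\<exists>u\<in>cspan E. norm u = 1 \<and> Re (cinner (?H u) u) \<le> s" using u by blast
  qed simp
  moreover have "Re (cis \<xi> * \<mu>) \<le> lambda_op (Suc (card C)) ?H"
    using \<mu> [of "Suc (card C)"] \<xi>(1) by (auto simp: Omega_def rotated_Re_def)
  ultimately show False using lt by simp
qed

section \<open>Points attained by every perturbation\<close>

text \<open>If \<open>\<mu>\<close> is not a value on \<open>ortho B\<close>, a supporting line separates it from these values, but possibly touches them, so
  the strict estimate used for closures is not available. The projection is therefore enlarged by an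
  orthonormal basis \<open>N\<close> of the span of the projection of \<open>B\<close> to the kernel \<open>Z\<close> of \<open>K = H - c\<close>: a unit vector where the perturbed form reaches \<open>c\<close> lies in
  \<open>Z\<close> and is orthogonal to \<open>N\<close>, hence to \<open>B\<close>.\<close>

lemma attained_on_finite_codimension:
  fixes A :: "'a::complex_hilbert \<Rightarrow> 'a"
  assumes inf: "\<not> cfinite_dim (UNIV :: 'a set)" and A: "bounded_clinear A"
    and \<mu>: "\<And>\<eta> E. \<eta> \<in> {0..<2*pi} \<Longrightarrow> finite E \<Longrightarrow> orthonormal_set E \<Longrightarrow>
      \<mu> \<in> num_range (\<lambda>x. A x + (2 * cis \<eta> * complex_of_real (onorm A)) *\<^sub>C fproj E x)"
    and B: "finite B"
  shows "\<exists>w. norm w = 1 \<and> w \<in> ortho B \<and> cinner (A w) w = \<mu>"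
proof (rule ccontr)
  let ?a = "onorm A"
  define W where "W = {cinner (A x) x | x. x \<in> ortho B \<and> norm x = 1}"
  assume "\<not> ?thesis"
  then have "\<mu> \<notin> W" by (auto simp: W_def)
  then have "0 \<notin> (\<lambda>z. z - \<mu>) ` W" by auto
  moreover have "convex ((\<lambda>z. z - \<mu>) ` W)"
    unfolding W_def by (rule convex_translation_subtract [OF toeplitz_hausdorff [OF A csubspace_ortho]])
  ultimately obtain d where d: "d \<noteq> 0" "\<And>z. z \<in> W \<Longrightarrow> 0 \<le> inner d (z - \<mu>)"
    using separating_hyperplane_set_0 [of "(\<lambda>z. z - \<mu>) ` W"] by auto
  obtain \<xi> where \<xi>: "\<And>z. inner d z = - cmod d * Re (cis \<xi> * z)"
    by (rule inner_as_rotation [OF d(1)], rule that)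
  let ?H = "rotated_Re \<xi> A"
  note H = rotated_Re [OF A, of \<xi>]
  define c where "c = Re (cis \<xi> * \<mu>)"
  have half_plane: "Re (cis \<xi> * z) \<le> c" if "z \<in> W" for z
  proof -
    have "cmod d * Re (cis \<xi> * (z - \<mu>)) \<le> 0" using d(2) [OF that] unfolding \<xi> by simp
    then have "Re (cis \<xi> * (z - \<mu>)) \<le> 0" using d(1) unfolding mult_le_0_iff by auto
    then show ?thesis by (simp add: c_def right_diff_distrib)
  qed
  define K where "K x = ?H x - complex_of_real c *\<^sub>C x" for x
  have K: "self_adj K" unfolding K_def [abs_def] by (rule self_adj_shift [OF H(1)])
  have bK: "bounded_clinear K" by (rule self_adjD(1) [OF K])
  have K_form: "Re (cinner (K x) x) = Re (cinner (?H x) x) - c * (norm x)\<^sup>2" for x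
    unfolding K_def by (rule shift_form)
  have neg: "Re (cinner (K x) x) \<le> 0" if x: "x \<in> ortho B" for x
  proof (cases "x = 0")
    case False
    let ?w = "complex_of_real (1 / norm x) *\<^sub>C x"
    have nw: "norm ?w = 1" using False by (simp add: norm_scaleC norm_divide)
    have "?w \<in> ortho B" by (rule complex_vec.subspace_scale [OF csubspace_ortho x])
    with nw have "cinner (A ?w) ?w \<in> W" by (auto simp: W_def)
    then have "Re (cinner (K ?w) ?w) \<le> 0" using half_plane nw by (simp add: K_form H(2))
    moreover have "Re (cinner (K ?w) ?w) = (1 / norm x)\<^sup>2 * Re (cinner (K x) x)"
      unfolding form_scaleC [OF bK] by (simp add: norm_divide del: of_real_power)
    moreover have "0 < (1 / norm x)\<^sup>2" using False by simp
    ultimately show ?thesis by (simp only: mult_le_0_iff) linarith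
  qed (simp add: cinner_simps)
  have \<mu>A: "cmod \<mu> \<le> ?a"
  proof -
    have "\<mu> \<in> num_range (\<lambda>x. A x + (2 * cis 0 * complex_of_real ?a) *\<^sub>C fproj {} x)"
      by (rule \<mu>) (auto simp: orthonormal_set_def)
    then obtain x where "norm x = 1" "\<mu> = cinner (A x) x"
      by (auto simp: num_range_eq fproj_def)
    then show ?thesis using cmod_form_le [OF A, of x] by simp
  qed
  \<comment> \<open>If \<open>c \<le> - \<parallel>A\<parallel>\<close>, then \<open>\<mu>\<close> and every value at a unit vector of \<open>ortho B\<close> are the unique point of the
    disc of radius \<open>\<parallel>A\<parallel>\<close> in the half-plane, contrary to the assumption on \<open>\<mu>\<close>.\<close>
  have ac: "0 < ?a + c"
  proof (rule ccontr)
    assume "\<not> 0 < ?a + c"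
    then have c_le: "c \<le> - ?a" by simp
    have extreme: "z = - complex_of_real ?a" if "cmod z \<le> ?a" "Re z \<le> - ?a" for z
    proof -
      have "(Re z)\<^sup>2 + (Im z)\<^sup>2 \<le> ?a\<^sup>2"
        using power_mono [OF that(1), of 2] by (simp add: cmod_power2)
      moreover have "?a\<^sup>2 \<le> (Re z)\<^sup>2"
        using that power_mono [of ?a "- Re z" 2] norm_ge_zero [of z] by simp
      ultimately have "(Im z)\<^sup>2 \<le> 0" by linarith
      then have "Im z = 0" by simp
      moreover have "Re z = - ?a"
        using that abs_Re_le_cmod [of z] by linarith
      ultimately show ?thesis by (simp add: complex_eq_iff)
    qed
    obtain w :: 'a where w: "norm w = 1" "w \<in> ortho B"
      using unit_vector_in_ortho [OF complex_vec.subspace_UNIV inf B] by blast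
    then have wW: "cinner (A w) w \<in> W" by (auto simp: W_def)
    have "cis \<xi> * cinner (A w) w = - complex_of_real ?a"
      using half_plane [OF wW] c_le cmod_form_le [OF A, of w] w(1)
      by (intro extreme) (auto simp: norm_mult)
    moreover have "cis \<xi> * \<mu> = - complex_of_real ?a"
      using c_le \<mu>A by (intro extreme) (auto simp: norm_mult c_def)
    ultimately have "cis \<xi> * cinner (A w) w = cis \<xi> * \<mu>" by simp
    then have "cinner (A w) w = \<mu>" by (simp add: cis_neq_zero)
    with wW \<open>\<mu> \<notin> W\<close> show False by simp
  qed
  obtain E where E: "finite E" "orthonormal_set E" "\<And>e. e \<in> E \<Longrightarrow> \<exists>\<kappa>>0. K e = complex_of_real \<kappa> *\<^sub>C e"
      "\<And>x. x \<in> ortho E \<Longrightarrow> Re (cinner (K x) x) \<le> 0"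
    by (rule finite_positive_part [OF K B neg], assumption, rule that)
  define Z where "Z = {x. K x = 0}"
  have Z: "csubspace Z" "closed Z"
  proof -
    show "csubspace Z"
      by (auto simp: Z_def complex_vec.subspace_def bounded_clinearD(2,3,5) [OF bK])
    show "closed Z" unfolding Z_def
      by (intro closed_Collect_eq continuous_on_const linear_continuous_on bounded_clinearD(1) [OF bK])
  qed
  obtain Q where Q: "orth_proj Q" "range Q = Z" "\<And>x y. y \<in> Z \<Longrightarrow> cinner (x - Q x) y = 0"
    by (rule orth_proj_onto_closed [OF Z(2,1)], rule that)
  obtain N where N: "finite N" "orthonormal_set N" "Q ` B \<subseteq> cspan N" "N \<subseteq> cspan (Q ` B)" "card N \<le> card (Q ` B)"
    by (rule gram_schmidt [OF finite_imageI [OF B]])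
  have NZ: "N \<subseteq> Z"
    using N(4) complex_vec.span_minimal [OF _ Z(1), of "Q ` B"] Q(2) by blast
  \<comment> \<open>For \<open>x \<in> Z\<close> the inner product with \<open>b\<close> equals that with \<open>Q b\<close>, so orthogonality to the finite set \<open>N\<close> suffices.\<close>
  have ZN: "x \<in> ortho B" if x: "x \<in> Z" "x \<in> ortho N" for x
    unfolding ortho_def
  proof safe
    fix b assume b: "b \<in> B"
    have "cinner (Q b) x = 0"
      by (rule ortho_cspan(2) [OF x(2)]) (use N(3) b in auto)
    moreover have "cinner (b - Q b) x = 0" by (rule Q(3) [OF x(1)])
    ultimately have "cinner b x = 0" by (simp add: cinner_simps)
    then show "cinner x b = 0" by (simp add: cinner_eq_zero_commute)
  qed
  have EN: "cinner e n = 0" if "e \<in> E" "n \<in> N" for e n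
  proof -
    obtain \<kappa> where \<kappa>: "\<kappa> > 0" "K e = complex_of_real \<kappa> *\<^sub>C e" using E(3) \<open>e \<in> E\<close> by blast
    have "K n = 0" using NZ that(2) by (auto simp: Z_def)
    then have "cinner (K e) n = 0" by (simp add: self_adjD(2) [OF K] cinner_simps)
    with \<kappa> show ?thesis by (simp add: cinner_simps)
  qed
  define G where "G = E \<union> N"
  have G: "finite G" "orthonormal_set G"
  proof -
    show "finite G" using E(1) N(1) by (simp add: G_def)
    have NE: "cinner n e = 0" if "e \<in> E" "n \<in> N" for e n
      using EN [OF that] by (simp add: cinner_eq_zero_commute)
    have disj: "e \<noteq> n" if "e \<in> E" "n \<in> N" for e n
      using EN [OF that] orthonormal_set_norm [OF E(2) that(1)] by (auto simp: cinner_self)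
    show "orthonormal_set G"
      unfolding orthonormal_set_def G_def
    proof safe
      fix e f
      show "e \<in> E \<Longrightarrow> f \<in> E \<Longrightarrow> cinner e f = (if e = f then 1 else 0)"
        using E(2) by (simp add: orthonormal_set_def)
      show "e \<in> N \<Longrightarrow> f \<in> N \<Longrightarrow> cinner e f = (if e = f then 1 else 0)"
        using N(2) by (simp add: orthonormal_set_def)
      show "e \<in> E \<Longrightarrow> f \<in> N \<Longrightarrow> cinner e f = (if e = f then 1 else 0)"
        using EN disj by auto
      show "e \<in> N \<Longrightarrow> f \<in> E \<Longrightarrow> cinner e f = (if e = f then 1 else 0)"
        using NE disj by auto
    qed
  qed
  have eig: "\<exists>\<kappa>. ?H e = complex_of_real \<kappa> *\<^sub>C e" if e: "e \<in> G" for e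
  proof -
    have "\<exists>\<kappa>. K e = complex_of_real \<kappa> *\<^sub>C e"
    proof (cases "e \<in> E")
      case False
      then have "K e = complex_of_real 0 *\<^sub>C e" using e NZ by (auto simp: G_def Z_def)
      then show ?thesis by blast
    qed (use E(3) in blast)
    then obtain \<kappa> where "K e = complex_of_real \<kappa> *\<^sub>C e" ..
    then have "?H e = complex_of_real (\<kappa> + c) *\<^sub>C e"
      by (simp add: K_def scaleC_add_left diff_eq_eq)
    then show ?thesis by blast
  qed
  have GE: "x \<in> ortho E" "x \<in> ortho N" if "x \<in> ortho G" for x
    using that by (auto simp: G_def ortho_def)
  obtain \<eta> where \<eta>: "\<eta> \<in> {0..<2*pi}" "cis \<eta> = - cnj (cis \<xi>)"
    by (rule unit_complex_cis [of "- cnj (cis \<xi>)"]) simp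
  obtain x where x: "norm x = 1"
      "\<mu> = cinner (A x + (2 * cis \<eta> * complex_of_real ?a) *\<^sub>C fproj G x) x"
    using \<mu> [OF \<eta>(1) G] by (auto simp: num_range_eq)
  have "c \<le> c - (?a + c) * (norm (fproj G x))\<^sup>2"
    using perturbed_form_le [OF A G eig \<eta>(2) x(1), of c] E(4) GE(1)
    by (fastforce simp: K_form c_def simp flip: x(2))
  then have "(?a + c) * (norm (fproj G x))\<^sup>2 \<le> 0" by simp
  then have p0: "fproj G x = 0" using ac by (simp add: mult_le_0_iff)
  then have xG: "x \<in> ortho G" using diff_fproj_ortho [OF G, of x] by simp
  have \<mu>x: "cinner (A x) x = \<mu>" using x(2) by (simp add: p0)
  \<comment> \<open>The form of \<open>- K\<close> is nonnegative on \<open>ortho E\<close> and vanishes at \<open>x\<close>.\<close>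
  have "K x = 0"
  proof -
    define D where "D y = - K y" for y
    have bD: "bounded_clinear D"
      using bounded_clinear_scaleC [OF bK, of "-1"] by (simp add: D_def [abs_def])
    have D: "self_adj D" using bD by (simp add: self_adj_def D_def cinner_simps self_adjD(2) [OF K])
    have inv: "D y \<in> ortho E" if "y \<in> ortho E" for y
    proof -
      have "K y \<in> ortho E" by (rule eigenvectors_ortho_invariant [OF K _ that]) (use E(3) in blast)
      then show ?thesis by (simp add: D_def ortho_def cinner_simps)
    qed
    have "Re (cinner (K x) x) = 0" using \<mu>x x(1) by (simp add: K_form H(2) c_def)
    then have "(norm (D x))\<^sup>2 \<le> 0"
      using positive_form_bound [OF D csubspace_ortho inv _ GE(1) [OF xG]] E(4)
      by (simp add: D_def cinner_simps)
    then show ?thesis by (simp add: D_def)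
  qed
  then have "x \<in> Z" by (simp add: Z_def)
  then have "x \<in> ortho B" using ZN GE(2) [OF xG] by blast
  with x(1) \<mu>x \<open>\<mu> \<notin> W\<close> show False by (auto simp: W_def)
qed

section \<open>The equalities\<close>

theorem theorem5p1:
  fixes A :: "'a::complex_hilbert \<Rightarrow> 'a" and S :: "('a \<Rightarrow> 'a) set"
  assumes infinite_dim: "\<not> cfinite_dim (UNIV :: 'a set)"
    and A: "bounded_clinear A"
    and S_finite_rank: "\<forall>F\<in>S. finite_rank_op F"
    and S_contains: "{\<lambda>x. (2 * cis \<xi> * complex_of_real (onorm A)) *\<^sub>C P x | \<xi> P.
        \<xi> \<in> {0..<2*pi} \<and> orth_proj P \<and> finite_rank_op P} \<subseteq> S"
  shows "(Omega_infinity A = (\<Inter>k\<in>{1..}. Omega k A)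
      \<and> (\<Inter>k\<in>{1..}. Omega k A) = (\<Inter>F\<in>S. closure (num_range (\<lambda>x. A x + F x)))
      \<and> (\<Inter>F\<in>S. closure (num_range (\<lambda>x. A x + F x))) = ess_num_range A)
    \<and> (Lambda \<infinity> A = (\<Inter>k\<in>{1..}. Lambda (enat k) A)
      \<and> (\<Inter>k\<in>{1..}. Lambda (enat k) A) = (\<Inter>F\<in>S. num_range (\<lambda>x. A x + F x)))"
proof -
  let ?Om = "\<Inter>k\<in>{1..}. Omega k A" and ?La = "\<Inter>k\<in>{1..}. Lambda (enat k) A"
  let ?Cl = "\<Inter>F\<in>S. closure (num_range (\<lambda>x. A x + F x))" and ?W = "\<Inter>F\<in>S. num_range (\<lambda>x. A x + F x)"
  have S: "(\<lambda>x. (2 * cis \<eta> * complex_of_real (onorm A)) *\<^sub>C fproj E x) \<in> S"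
    if "\<eta> \<in> {0..<2*pi}" "finite E" "orthonormal_set E" for \<eta> E
    using S_contains orth_proj_fproj [OF that(2,3)] finite_rank_fproj [OF that(2,3)] that(1) by blast
  have Om: "Omega_infinity A = ?Om"
    by (auto simp: Omega_infinity_def Omega_def)
  have Cl_Om: "?Cl \<subseteq> ?Om"
  proof (intro subsetI INT_I)
    fix \<mu> k assume \<mu>: "\<mu> \<in> ?Cl" and k: "(k::nat) \<in> {1..}"
    show "\<mu> \<in> Omega k A"
      by (rule closure_num_range_subset_Omega [OF infinite_dim A])
        (use \<mu> k S in \<open>auto simp del: atLeastLessThan_iff\<close>)
  qed
  have Om_We: "?Om \<subseteq> ess_num_range A"
    unfolding ess_num_range_def
    using Omega_subset_closure_num_range [OF infinite_dim A] by auto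
  have We_Cl: "ess_num_range A \<subseteq> ?Cl"
    using S_finite_rank by (auto simp: ess_num_range_def)
  have inf_La: "Lambda \<infinity> A \<subseteq> ?La"
    using Lambda_infinity_subset by blast
  have La_W: "?La \<subseteq> ?W"
  proof (intro subsetI INT_I)
    fix \<mu> F assume "\<mu> \<in> ?La" "F \<in> S"
    then show "\<mu> \<in> num_range (\<lambda>x. A x + F x)"
      using S_finite_rank by (intro Lambda_finite_in_num_range) auto
  qed
  have W_inf: "?W \<subseteq> Lambda \<infinity> A"
  proof
    fix \<mu> assume \<mu>: "\<mu> \<in> ?W"
    have "\<exists>w. norm w = 1 \<and> w \<in> ortho B \<and> cinner (A w) w = \<mu>" if "finite B" for B
      by (rule attained_on_finite_codimension [OF infinite_dim A _ that])
        (use \<mu> S in \<open>auto simp del: atLeastLessThan_iff\<close>)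
    then show "\<mu> \<in> Lambda \<infinity> A" by (rule Lambda_infinityI [OF A])
  qed
  show ?thesis
  proof (intro conjI)
    show "?Om = ?Cl" by (rule subset_antisym [OF subset_trans [OF Om_We We_Cl] Cl_Om])
    show "?Cl = ess_num_range A" by (rule subset_antisym [OF subset_trans [OF Cl_Om Om_We] We_Cl])
    show "Lambda \<infinity> A = ?La" by (rule subset_antisym [OF inf_La subset_trans [OF La_W W_inf]])
    show "?La = ?W" by (rule subset_antisym [OF La_W subset_trans [OF W_inf inf_La]])
  qed (rule Om)
qed

end
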